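(* Assume GCH. Let $X$ be a homogeneous compact Hausdorff space. Then $\mathrm{Nt}(X^n)=\mathrm{Nt}(X)$ for every positive integer $n$.
   Context: For a cardinal $\kappa$, a family $\mathcal B$ of sets is called $\kappa^{\mathrm{op}}$-like if for every $U\in\mathcal B$ the set $\{V\in\mathcal B: U\subseteq V\}$ has cardinality $<\kappa$. The Noetherian type $\mathrm{Nt}(X)$ of a topological space $X$ is the least infinite cardinal $\kappa$ such that $X$ has a base which is $\kappa^{\mathrm{op}}$-like. A space is homogeneous if for all points $p,q$ there is a self-homeomorphism taking $p$ to $q$. $X^n$ carries the product topology. *)

theory Defs
  imports "HOL-Analysis.Analysis"
begin

unbundle cardinal_syntax

definition topology_base :: "'a topology \<Rightarrow> 'a set set \<Rightarrow> bool" where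
  "topology_base X \<B> \<longleftrightarrow> openin X = arbitrary union_of (\<lambda>U. U \<in> \<B>)"

definition homogeneous_space :: "'a topology \<Rightarrow> bool" where
  "homogeneous_space X \<longleftrightarrow>
     (\<forall>p\<in>topspace X. \<forall>q\<in>topspace X. \<exists>f. homeomorphic_map X X f \<and> f p = q)"

text \<open>Cardinals are represented, as in the cardinal library of HOL, by minimal well-orders
  (\<open>Card_order\<close>), and are identified up to \<open>=o\<close>.\<close>

definition op_like :: "'k rel \<Rightarrow> 'a set set \<Rightarrow> bool" where
  "op_like \<kappa> \<B> \<longleftrightarrow> (\<forall>U\<in>\<B>. |{V \<in> \<B>. U \<subseteq> V}| <o \<kappa>)"

definition has_op_like_base :: "'a topology \<Rightarrow> 'k rel \<Rightarrow> bool" where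
  "has_op_like_base X \<kappa> \<longleftrightarrow> (\<exists>\<B>. topology_base X \<B> \<and> op_like \<kappa> \<B>)"

text \<open>The type \<open>(nat + 'a set) set\<close> is infinite and strictly larger than any family of subsets
  of \<open>'a\<close>, so it carries an infinite cardinal for which every base is op-like; the choice
  below is therefore never void (\<open>Noetherian_type_spec\<close>). Minimality among
  the cardinals on this type is minimality among all cardinals
  (\<open>Noetherian_type_least\<close>).\<close>

definition Noetherian_type :: "'a topology \<Rightarrow> (nat + 'a set) set rel" where
  "Noetherian_type X = (SOME \<kappa>. Cinfinite \<kappa> \<and> has_op_like_base X \<kappa> \<and>
     (\<forall>\<mu> :: (nat + 'a set) set rel.
        Cinfinite \<mu> \<and> has_op_like_base X \<mu> \<longrightarrow> \<kappa> \<le>o \<mu>))"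

text \<open>HOL cannot quantify over all cardinals at once; this is \<open>2\<^sup>\<kappa> = \<kappa>\<^sup>+\<close> for every infinite
  cardinal \<open>\<kappa>\<close> of size at most that of the type \<open>'c\<close>.\<close>

definition GCH_upto :: "'c itself \<Rightarrow> bool" where
  "GCH_upto _ \<longleftrightarrow> (\<forall>\<kappa> :: 'c rel. Cinfinite \<kappa> \<longrightarrow> ctwo ^c \<kappa> =o cardSuc \<kappa>)"

lemma op_like_mono: "op_like \<kappa> \<B> \<Longrightarrow> \<kappa> \<le>o \<mu> \<Longrightarrow> op_like \<mu> \<B>"
  unfolding op_like_def using ordLess_ordLeq_trans by blast

lemma has_op_like_base_mono: "has_op_like_base X \<kappa> \<Longrightarrow> \<kappa> \<le>o \<mu> \<Longrightarrow> has_op_like_base X \<mu>"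
  unfolding has_op_like_base_def using op_like_mono by blast

lemma has_op_like_base_exists:
  fixes X :: "'a topology"
  shows "\<exists>\<kappa> :: (nat + 'a set) set rel. Cinfinite \<kappa> \<and> has_op_like_base X \<kappa>"
proof -
  let ?r = "|UNIV :: (nat + 'a set) set set|"
  have "infinite (UNIV :: (nat + 'a set) set set)"
    by (simp add: Finite_Set.finite_set)
  then have c: "Cinfinite ?r"
    using card_of_Card_order by (auto simp: cinfinite_def Field_card_of)
  have base: "topology_base X {U. openin X U}"
    unfolding topology_base_def openin_topology_base_unique by blast
  have "|\<C>| <o ?r" for \<C> :: "'a set set"
  proof -
    have "|\<C>| \<le>o |UNIV :: (nat + 'a set) set|"
      by (rule card_of_ordLeqI[of Inr]) (auto simp: inj_on_def)
    then show ?thesis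
      using card_of_Pow[of "UNIV :: (nat + 'a set) set"] ordLeq_ordLess_trans
      unfolding Pow_UNIV by blast
  qed
  then have "has_op_like_base X ?r"
    unfolding has_op_like_base_def op_like_def using base by blast
  with c show ?thesis by blast
qed

lemma Noetherian_type_spec:
  fixes X :: "'a topology"
  shows "Cinfinite (Noetherian_type X) \<and> has_op_like_base X (Noetherian_type X) \<and>
    (\<forall>\<mu> :: (nat + 'a set) set rel.
       Cinfinite \<mu> \<and> has_op_like_base X \<mu> \<longrightarrow> Noetherian_type X \<le>o \<mu>)"
proof -
  let ?S = "{\<kappa> :: (nat + 'a set) set rel. Cinfinite \<kappa> \<and> has_op_like_base X \<kappa>}"
  obtain \<kappa> where \<kappa>: "\<kappa> \<in> ?S" "\<And>\<mu>. (\<mu>, \<kappa>) \<in> ordLess \<Longrightarrow> \<mu> \<notin> ?S"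
    using has_op_like_base_exists[of X] wfE_min[OF wf_ordLess, of _ ?S] by blast
  have "\<kappa> \<le>o \<mu>" if "\<mu> \<in> ?S" for \<mu>
    using \<kappa> that not_ordLess_iff_ordLeq[of \<kappa> \<mu>] unfolding card_order_on_def by blast
  with \<kappa>(1) have "\<exists>\<kappa> :: (nat + 'a set) set rel. Cinfinite \<kappa> \<and> has_op_like_base X \<kappa> \<and>
     (\<forall>\<mu> :: (nat + 'a set) set rel.
        Cinfinite \<mu> \<and> has_op_like_base X \<mu> \<longrightarrow> \<kappa> \<le>o \<mu>)"
    by blast
  then show ?thesis
    unfolding Noetherian_type_def by (rule someI_ex)
qed

lemma Noetherian_type_least:
  fixes X :: "'a topology" and \<mu> :: "'k rel"
  assumes "Cinfinite \<mu>" "has_op_like_base X \<mu>"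
  shows "Noetherian_type X \<le>o \<mu>"
proof (rule ccontr)
  let ?N = "Noetherian_type X"
  have N: "Card_order ?N" using Noetherian_type_spec[of X] by blast
  assume neg: "\<not> ?N \<le>o \<mu>"
  then have less: "\<mu> <o ?N"
    using assms(1) N not_ordLeq_iff_ordLess[of \<mu> ?N] unfolding card_order_on_def by blast
  then obtain \<nu> :: "(nat + 'a set) set rel" where \<nu>: "\<mu> =o \<nu>"
    using internalize_ordLess[of \<mu> ?N] by blast
  have "Cinfinite \<nu>"
    using Cinfinite_cong[OF \<nu> assms(1)] .
  moreover have "has_op_like_base X \<nu>"
    using has_op_like_base_mono[OF assms(2)] \<nu> ordIso_iff_ordLeq by blast
  ultimately have "?N \<le>o \<nu>"
    using Noetherian_type_spec[of X] by blast
  then show False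
    using neg \<nu> ordIso_symmetric ordLeq_ordIso_trans by blast
qed

end

theory Submission
  imports Defs "HOL-Algebra.Free_Abelian_Groups"
begin

text \<open>
  The inequality \<open>Nt(X\<^sup>n) \<le> Nt(X)\<close> comes from boxes: those with nonempty
  sides from a \<open>\<kappa>\<close>-op-like base form a \<open>\<kappa>\<close>-op-like base of the power, because a nonempty
  box inside another box has smaller sides (\<open>power_op_like_base\<close>).

  For the converse, let \<open>\<mu>\<close> be the character of \<open>X\<close>, that is, the least size of a local base
  at a point; by homogeneity it does not depend on the point. A finite space has only finitely many
  open sets, so assume that \<open>X\<close> is infinite; then \<open>\<mu>\<close> is infinite, too. Let \<open>\<B>\<close> be a
  \<open>\<kappa>\<close>-op-like base of \<open>X\<^sup>n\<close>.

  Suppose first that \<open>X\<close> has a base \<open>\<E>\<close> of size at most \<open>\<mu>\<close>. Run through the at most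
  \<open>\<mu>\<close> pairs \<open>U \<subseteq> V\<close> from \<open>\<E>\<close> that have a closed set between them, and cover \<open>U\<close> by finitely many
  open \<open>Z \<subseteq> V\<close>, each witnessed by some \<open>G \<in> \<B>\<close> with \<open>Z\<^sup>n \<subseteq> G \<subseteq> V\<^sup>n\<close> that
  no earlier pair has used. Unused witnesses are always available, since fewer than \<open>\<mu>\<close> sets
  have been used, and these cannot restrict to a local base at a diagonal point. The sets \<open>Z\<close> form a
  base of \<open>X\<close>. If \<open>W \<subseteq> Z\<close>, then the witness of \<open>Z\<close> contains any fixed member of \<open>\<B>\<close> below
  \<open>W\<^sup>n\<close>; so there are fewer than \<open>\<kappa>\<close> witnesses, and each witnesses only finitely many \<open>Z\<close>
  (\<open>op_like_base_from_power\<close>).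

  Suppose now that every base of \<open>X\<close> has more than \<open>\<mu>\<close> elements. Arhangel'skii's bound
  \<open>|X| \<le> 2\<^sup>\<mu>\<close> (\<open>card_of_compact_space\<close>) and GCH give a base of size \<open>\<mu>\<^sup>+\<close>, which is
  trivially \<open>\<mu>\<^sup>+\<^sup>+\<close>-op-like. It remains to see that \<open>\<kappa> \<ge> \<mu>\<^sup>+\<^sup>+\<close>. Otherwise each nonempty
  \<open>U \<in> \<B>\<close> has at most \<open>\<mu>\<close> supersets in \<open>\<B>\<close>, and then \<open>\<B>\<close> has at most \<open>\<mu>\<close> elements
  (\<open>card_of_base_le_character\<close>); restricting \<open>\<B>\<close> to the diagonal yields a base of \<open>X\<close> of that
  size, a contradiction.

  Both cardinal bounds on compact spaces come from a single closing-off lemma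
  (\<open>closing_off\<close>), applied to operations on sets of at most \<open>\<mu>\<close> points in one case and on
  finite sets of open sets in the other.
\<close>

section \<open>Cardinal bounds\<close>

lemma card_finite_ordLess:
  assumes "Cinfinite \<kappa>" "finite A"
  shows "|A| <o \<kappa>"
  using assms by (intro Cfinite_ordLess_Cinfinite) (simp_all add: cfinite_def Field_card_of card_of_Card_order)

lemma UN_finite_ordLess:
  assumes \<kappa>: "Cinfinite \<kappa>" and I: "|I| <o \<kappa>" and A: "\<And>i. i \<in> I \<Longrightarrow> finite (A i)"
  shows "|\<Union>i\<in>I. A i| <o \<kappa>"
proof (cases "finite I")
  case True
  then show ?thesis using A card_finite_ordLess[OF \<kappa>] by blast
next
  case False
  have "|\<Union>i\<in>I. A i| \<le>o |I|"
  proof (rule card_of_UNION_ordLeq_infinite[OF False])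
    show "\<forall>i\<in>I. |A i| \<le>o |I|"
      using A False
      by (metis card_of_Card_order card_finite_ordLess cinfinite_def Field_card_of ordLess_imp_ordLeq)
  qed (simp add: ordLeq_refl)
  then show ?thesis using I by (rule ordLeq_ordLess_trans)
qed

lemma card_of_PiE_ordLess:
  assumes \<kappa>: "Cinfinite \<kappa>" and "finite I" "\<And>i. i \<in> I \<Longrightarrow> |A i| <o \<kappa>"
  shows "|Pi\<^sub>E I A| <o \<kappa>"
  using assms(2,3)
proof (induction I)
  case empty
  show ?case by (rule card_finite_ordLess[OF \<kappa>]) simp
next
  case (insert x I)
  have "|A x \<times> Pi\<^sub>E I A| <o \<kappa>"
  proof (rule card_of_Times_ordLess_infinite_Field)
    show "infinite (Field \<kappa>)" "Card_order \<kappa>"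
      using \<kappa> unfolding cinfinite_def by blast+
    show "|A x| <o \<kappa>" by (rule insert.prems) simp
    show "|Pi\<^sub>E I A| <o \<kappa>" by (intro insert.IH insert.prems) simp
  qed
  then show ?case
    unfolding PiE_insert_eq by (rule ordLeq_ordLess_trans[OF card_of_image])
qed

lemma card_of_ordLess_cardSuc_iff:
  assumes "Cinfinite \<mu>"
  shows "|S| <o cardSuc \<mu> \<longleftrightarrow> |S| \<le>o \<mu>"
  using assms by (intro cardSuc_ordLeq_ordLess card_of_Card_order) blast

lemma card_of_PiE_ordLeq:
  assumes \<mu>: "Cinfinite \<mu>" and "finite I" "\<And>i. i \<in> I \<Longrightarrow> |A i| \<le>o \<mu>"
  shows "|Pi\<^sub>E I A| \<le>o \<mu>"
proof -
  note less_Suc = card_of_ordLess_cardSuc_iff[OF \<mu>]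
  have "|Pi\<^sub>E I A| <o cardSuc \<mu>"
    using assms(2,3) unfolding less_Suc[symmetric]
    by (rule card_of_PiE_ordLess[OF Cinfinite_cardSuc[OF \<mu>]])
  then show ?thesis unfolding less_Suc .
qed

lemma card_of_finite_subsets_ordLeq:
  assumes \<mu>: "Cinfinite \<mu>" and S: "|S| \<le>o \<mu>"
  shows "|{A. A \<subseteq> S \<and> finite A}| \<le>o \<mu>"
proof (cases "finite S")
  case True
  then have "finite {A. A \<subseteq> S \<and> finite A}" by simp
  then show ?thesis using card_finite_ordLess[OF \<mu>] ordLess_imp_ordLeq by blast
next
  case False
  then show ?thesis
    using card_of_Fpow_infinite[OF False] S ordIso_ordLeq_trans unfolding Fpow_def by blast
qed

text \<open>
  A nonempty subset of size at most \<open>\<mu>\<close> is the image of a function on \<open>Field \<mu>\<close>, and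
  \<open>(2\<^sup>\<mu>)\<^sup>\<mu> = 2\<^sup>\<mu>\<close>.
\<close>
lemma card_of_small_subsets_ordLeq:
  fixes S :: "'a set"
  assumes \<mu>: "Cinfinite \<mu>" and S: "|S| \<le>o ctwo ^c \<mu>"
  shows "|{A. A \<subseteq> S \<and> |A| \<le>o \<mu>}| \<le>o ctwo ^c \<mu>"
proof -
  have l: "Cinfinite (ctwo ^c \<mu>)"
    using \<mu> Cinfinite_cexp[OF ordLeq_refl[OF Card_order_ctwo]] by blast
  have sub: "{A. A \<subseteq> S \<and> |A| \<le>o \<mu>} \<subseteq> {{}} \<union> (\<lambda>f. f ` Field \<mu>) ` Func (Field \<mu>) S"
  proof clarsimp
    fix A assume A: "A \<subseteq> S" "|A| \<le>o \<mu>" "A \<notin> (\<lambda>f. f ` Field \<mu>) ` Func (Field \<mu>) S"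
    show "A = {}"
    proof (rule ccontr)
      assume "A \<noteq> {}"
      moreover have "|A| \<le>o |Field \<mu>|"
        using A(2) \<mu> card_of_Field_ordIso ordIso_symmetric ordLeq_ordIso_trans by blast
      ultimately obtain g where g: "g ` Field \<mu> = A"
        using card_of_ordLeq2 by metis
      then have "(\<lambda>i. if i \<in> Field \<mu> then g i else undefined) \<in> Func (Field \<mu>) S"
        using A(1) by (auto simp: Func_def)
      moreover have "A = (\<lambda>i. if i \<in> Field \<mu> then g i else undefined) ` Field \<mu>"
        using g by (auto simp: image_iff)
      ultimately show False using A(3) by blast
    qed
  qed
  have "|(\<lambda>f. f ` Field \<mu>) ` Func (Field \<mu>) S| \<le>o ctwo ^c \<mu>"
  proof -
    have "|(\<lambda>f. f ` Field \<mu>) ` Func (Field \<mu>) S| \<le>o |Func (Field \<mu>) S|"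
      by (rule card_of_image)
    also have "|Func (Field \<mu>) S| =o |S| ^c \<mu>"
      by (simp add: cexp_def Field_card_of ordIso_refl)
    also have "|S| ^c \<mu> \<le>o (ctwo ^c \<mu>) ^c \<mu>"
      using S \<mu> by (intro cexp_mono1) auto
    also have "(ctwo ^c \<mu>) ^c \<mu> =o ctwo ^c \<mu>"
      using \<mu> Cinfinite_Cnotzero[OF \<mu>] by (intro cexp_cprod_ordLeq) (auto simp: Card_order_ctwo ordLeq_refl)
    finally show ?thesis .
  qed
  moreover have "|{{}} :: 'a set set| \<le>o ctwo ^c \<mu>"
    using card_finite_ordLess[OF l] ordLess_imp_ordLeq by blast
  ultimately have "|{{}} \<union> (\<lambda>f. f ` Field \<mu>) ` Func (Field \<mu>) S| \<le>o ctwo ^c \<mu>"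
    by (intro Un_Cinfinite_bound l)
  then show ?thesis by (rule ordLeq_transitive[OF card_of_mono1[OF sub]])
qed

section \<open>Closing off under operations on small sets\<close>

text \<open>
  The points that have entered the closure under \<open>\<Phi>\<close> by step \<open>i\<close>. Only \<open>\<Phi>\<close> adds points: the
  seed of the construction is \<open>\<Phi> {}\<close>.
\<close>
inductive stage :: "'r rel \<Rightarrow> ('b set \<Rightarrow> 'b set) \<Rightarrow> 'r \<Rightarrow> 'b \<Rightarrow> bool" for r \<Phi> where
  "\<lbrakk>i \<in> Field r; |A| <o r; \<forall>a\<in>A. \<exists>j. j \<in> underS r i \<and> stage r \<Phi> j a; x \<in> \<Phi> A\<rbrakk> \<Longrightarrow> stage r \<Phi> i x"

text \<open>
  Iterating \<open>\<Phi>\<close> along \<open>r\<close> reaches a closed set because \<open>r\<close> is regular: a subset of the union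
  of the stages of size less than \<open>r\<close> is already contained in one stage. The counting assumption
  keeps each stage at size at most \<open>l\<close>; there are no more than \<open>l\<close> stages.
\<close>
lemma closing_off:
  fixes \<Phi> :: "'b set \<Rightarrow> 'b set" and r :: "'r rel" and l :: "'l rel"
  assumes r: "Cinfinite r" "regularCard r" and l: "Cinfinite l" "r \<le>o l"
    and count: "\<And>S::'b set. |S| \<le>o l \<Longrightarrow> |{A. A \<subseteq> S \<and> |A| <o r}| \<le>o l"
    and \<Phi>: "\<And>A. |A| <o r \<Longrightarrow> |\<Phi> A| \<le>o l"
  obtains H where "|H| \<le>o l" "\<And>A. A \<subseteq> H \<Longrightarrow> |A| <o r \<Longrightarrow> \<Phi> A \<subseteq> H"
proof -
  define As where "As i = {x. stage r \<Phi> i x}" for i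
  have wo: "wo_rel r" using r(1) unfolding wo_rel_def card_order_on_def by blast
  have As_eq: "As i = (\<Union>A\<in>{A. A \<subseteq> (\<Union>j\<in>underS r i. As j) \<and> |A| <o r}. \<Phi> A)" if "i \<in> Field r" for i
  proof (rule Set.set_eqI)
    fix x
    have "stage r \<Phi> i x \<longleftrightarrow>
        (\<exists>A. |A| <o r \<and> (\<forall>a\<in>A. \<exists>j. j \<in> underS r i \<and> stage r \<Phi> j a) \<and> x \<in> \<Phi> A)"
      using that by (subst stage.simps) simp
    then show "x \<in> As i \<longleftrightarrow> x \<in> (\<Union>A\<in>{A. A \<subseteq> (\<Union>j\<in>underS r i. As j) \<and> |A| <o r}. \<Phi> A)"
      unfolding As_def by blast
  qed
  have Field: "|Field r| \<le>o l"
    using ordIso_ordLeq_trans[OF card_of_Field_ordIso l(2)] r(1) by blast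
  have card_As: "i \<in> Field r \<longrightarrow> |As i| \<le>o l" for i
  proof (induction i rule: wo_rel.well_order_induct[OF wo])
    case (1 i)
    show ?case
    proof
      assume i: "i \<in> Field r"
      have "|underS r i| \<le>o l"
        using ordLeq_transitive[OF card_of_mono1[OF Order_Relation.underS_Field] Field] .
      then have "|\<Union>j\<in>underS r i. As j| \<le>o l"
      proof (intro UNION_Cinfinite_bound l(1) ballI)
        fix j assume "j \<in> underS r i"
        then have "j \<noteq> i \<and> (j, i) \<in> r" "j \<in> Field r" by (auto simp: underS_def Field_def)
        then show "|As j| \<le>o l" using 1 by blast
      qed
      from count[OF this] show "|As i| \<le>o l"
        unfolding As_eq[OF i] using \<Phi> by (intro UNION_Cinfinite_bound l(1)) simp_all
    qed
  qed
  have "|\<Union>i\<in>Field r. As i| \<le>o l"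
    using Field card_As by (intro UNION_Cinfinite_bound l(1)) simp_all
  moreover have "\<Phi> A \<subseteq> (\<Union>i\<in>Field r. As i)" if A: "A \<subseteq> (\<Union>i\<in>Field r. As i)" "|A| <o r" for A
  proof -
    have "relChain r As"
      unfolding relChain_def
    proof clarify
      fix i j x assume ij: "(i, j) \<in> r" and x: "x \<in> As i"
      then have F: "i \<in> Field r" "j \<in> Field r" by (auto simp: Field_def)
      have "underS r i \<subseteq> underS r j"
        using underS_incr[OF wo_rel.TRANS[OF wo] wo_rel.ANTISYM[OF wo] ij] .
      then have "(\<Union>k\<in>underS r i. As k) \<subseteq> (\<Union>k\<in>underS r j. As k)" by (rule UN_mono) simp
      then have "As i \<subseteq> As j"
        unfolding As_eq[OF F(1)] As_eq[OF F(2)] by (intro UN_mono Collect_mono) auto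
      with x show "x \<in> As j" by (rule subsetD[rotated])
    qed
    then obtain i where i: "i \<in> Field r" "A \<subseteq> As i"
      using regularCard_UNION[OF conjunct2[OF r(1)] r(2) _ A] by blast
    obtain j where j: "j \<in> Field r" "i \<noteq> j" "(i, j) \<in> r"
      using infinite_Card_order_limit[OF conjunct2[OF r(1)] _ i(1)] r(1)
      unfolding cinfinite_def by metis
    then have "A \<subseteq> (\<Union>j\<in>underS r j. As j)" using i by (auto simp: underS_def)
    then have "\<Phi> A \<subseteq> As j"
      unfolding As_eq[OF j(1)] using A(2) by (intro UN_upper) simp
    then show ?thesis using j(1) by blast
  qed
  ultimately show ?thesis using that by blast
qed

section \<open>Bases and local bases\<close>

lemma topology_base_iff:
  "topology_base X \<B> \<longleftrightarrow> (\<forall>V\<in>\<B>. openin X V) \<and>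
     (\<forall>U x. openin X U \<and> x \<in> U \<longrightarrow> (\<exists>V\<in>\<B>. x \<in> V \<and> V \<subseteq> U))"
  unfolding topology_base_def openin_topology_base_unique by blast

definition local_base :: "'a topology \<Rightarrow> 'a \<Rightarrow> 'a set set \<Rightarrow> bool" where
  "local_base X p \<L> \<longleftrightarrow> (\<forall>V\<in>\<L>. openin X V \<and> p \<in> V) \<and>
     (\<forall>U. openin X U \<and> p \<in> U \<longrightarrow> (\<exists>V\<in>\<L>. V \<subseteq> U))"

section \<open>The cardinality of a compact space of bounded character\<close>

text \<open>
  Arhangel'skii's theorem for compact spaces. Close off under two operations: \<open>lim\<close> adds the
  adherent points of subsets of size at most \<open>\<mu>\<close>, and \<open>c\<close> picks a point outside every finite
  union of basic neighbourhoods of points already present. Since local bases have size at most \<open>\<mu>\<close>,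
  the result \<open>H\<close> is closed, hence compact. A point \<open>q\<close> outside \<open>H\<close> would give a finite cover of
  \<open>H\<close> by basic neighbourhoods missing \<open>q\<close>, but \<open>c\<close> then yields a point of \<open>H\<close> that is not
  covered.
\<close>
lemma card_of_compact_space:
  assumes X: "compact_space X" "Hausdorff_space X" and \<mu>: "Cinfinite \<mu>"
    and lb: "\<And>p. p \<in> topspace X \<Longrightarrow> \<exists>\<L>. local_base X p \<L> \<and> |\<L>| \<le>o \<mu>"
  shows "|topspace X| \<le>o ctwo ^c \<mu>"
proof -
  obtain L where L: "\<And>p. p \<in> topspace X \<Longrightarrow> local_base X p (L p)"
      "\<And>p. p \<in> topspace X \<Longrightarrow> |L p| \<le>o \<mu>"
    using lb by metis
  define r where "r = cardSuc \<mu>"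
  define l where "l = ctwo ^c \<mu>"
  have r: "Cinfinite r" "regularCard r"
    using Cinfinite_cardSuc[OF \<mu>] regularCard_cardSuc[OF \<mu>] by (auto simp: r_def)
  have l: "Cinfinite l" unfolding l_def
    using \<mu> Cinfinite_cexp[OF ordLeq_refl[OF Card_order_ctwo]] by blast
  have \<mu>l: "\<mu> <o l" using ordLess_ctwo_cexp \<mu> by (auto simp: l_def)
  then have rl: "r \<le>o l" unfolding r_def using \<mu> l by (intro cardSuc_least) auto
  have less_r: "|S| <o r \<longleftrightarrow> |S| \<le>o \<mu>" for S :: "'c set"
    unfolding r_def by (rule card_of_ordLess_cardSuc_iff[OF \<mu>])
  have small: "|{A. A \<subseteq> S \<and> |A| \<le>o \<mu>}| \<le>o l" if "|S| \<le>o l" for S :: "'c set"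
    using card_of_small_subsets_ordLeq[OF \<mu>] that unfolding l_def by blast
  define lim where "lim A = {p \<in> topspace X. \<forall>V\<in>L p. V \<inter> A \<noteq> {}}" for A
  define c where "c \<V> = (SOME x. x \<in> topspace X - \<Union>\<V>)" for \<V>
  define \<Phi> where "\<Phi> A = lim A \<union> c ` {\<V>. \<V> \<subseteq> (\<Union>x\<in>A \<inter> topspace X. L x) \<and> finite \<V>}" for A
  have "|\<Phi> A| \<le>o l" if "|A| <o r" for A
  proof -
    have A: "|A| \<le>o \<mu>" using that less_r by blast
    have "|lim A| \<le>o l"
    proof -
      have "|Pow A| \<le>o l"
      proof -
        have "|{B. B \<subseteq> A \<and> |B| \<le>o \<mu>}| \<le>o l"
          using A \<mu>l by (intro small) (meson ordLeq_ordLess_trans ordLess_imp_ordLeq)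
        moreover have "{B. B \<subseteq> A \<and> |B| \<le>o \<mu>} = Pow A"
          using ordLeq_transitive[OF card_of_mono1 A] by blast
        ultimately show ?thesis by simp
      qed
      from small[OF this] have "|{\<A>. \<A> \<subseteq> Pow A \<and> |\<A>| \<le>o \<mu>}| \<le>o l" .
      moreover have "|lim A| \<le>o |{\<A>. \<A> \<subseteq> Pow A \<and> |\<A>| \<le>o \<mu>}|"
      proof (rule card_of_ordLeqI)
        \<comment> \<open>The traces on \<open>A\<close> of the basic neighbourhoods of an adherent point determine the
          point, because the space is Hausdorff.\<close>
        show "inj_on (\<lambda>p. (\<lambda>V. V \<inter> A) ` L p) (lim A)"
        proof (rule inj_onI, rule ccontr)
          fix p q assume pq: "p \<in> lim A" "q \<in> lim A" "(\<lambda>V. V \<inter> A) ` L p = (\<lambda>V. V \<inter> A) ` L q" "p \<noteq> q"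
          then have T: "p \<in> topspace X" "q \<in> topspace X" by (auto simp: lim_def)
          then obtain U V where UV: "openin X U" "openin X V" "p \<in> U" "q \<in> V" "disjnt U V"
            using X(2)[unfolded Hausdorff_space_def, rule_format, of p q] pq(4) by blast
          obtain P Q where PQ: "P \<in> L p" "P \<subseteq> U" "Q \<in> L q" "Q \<subseteq> V"
            using UV L(1)[OF T(1)] L(1)[OF T(2)] unfolding local_base_def by metis
          have "P \<inter> A \<in> (\<lambda>V. V \<inter> A) ` L q"
            unfolding pq(3)[symmetric] using PQ(1) by (rule imageI)
          then obtain P' where P': "P' \<in> L q" "P' \<inter> A = P \<inter> A" by auto
          have "openin X (P' \<inter> Q)" "q \<in> P' \<inter> Q"
            using P' PQ L(1)[OF T(2)] unfolding local_base_def by auto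
          then obtain W where "W \<in> L q" "W \<subseteq> P' \<inter> Q"
            using L(1)[OF T(2)] unfolding local_base_def by blast
          then have "P' \<inter> Q \<inter> A \<noteq> {}" using pq(2) unfolding lim_def by blast
          moreover have "P' \<inter> Q \<inter> A \<subseteq> U \<inter> V" using P'(2) PQ by blast
          ultimately show False using UV(5) by (auto simp: disjnt_def)
        qed
        show "(\<lambda>V. V \<inter> A) ` L p \<in> {\<A>. \<A> \<subseteq> Pow A \<and> |\<A>| \<le>o \<mu>}" if "p \<in> lim A" for p
        proof -
          have "|(\<lambda>V. V \<inter> A) ` L p| \<le>o \<mu>"
            using that ordLeq_transitive[OF card_of_image L(2)[of p]] unfolding lim_def by blast
          then show ?thesis by blast
        qed
      qed
      ultimately show ?thesis by (rule ordLeq_transitive[rotated])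
    qed
    moreover have "|c ` {\<V>. \<V> \<subseteq> (\<Union>x\<in>A \<inter> topspace X. L x) \<and> finite \<V>}| \<le>o l"
    proof -
      have "|\<Union>x\<in>A \<inter> topspace X. L x| \<le>o \<mu>"
        using L(2) ordLeq_transitive[OF card_of_mono1[of "A \<inter> topspace X" A] A]
        by (intro UNION_Cinfinite_bound \<mu>) simp_all
      then have "|{\<V>. \<V> \<subseteq> (\<Union>x\<in>A \<inter> topspace X. L x) \<and> finite \<V>}| \<le>o \<mu>"
        by (rule card_of_finite_subsets_ordLeq[OF \<mu>])
      then show ?thesis
        using ordLeq_transitive[OF card_of_image] ordLeq_transitive[OF _ ordLess_imp_ordLeq[OF \<mu>l]]
        by blast
    qed
    ultimately show ?thesis unfolding \<Phi>_def by (rule Un_Cinfinite_bound[OF _ _ l])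
  qed
  moreover have "|{A. A \<subseteq> S \<and> |A| <o r}| \<le>o l" if "|S| \<le>o l" for S :: "'a set"
    unfolding less_r using small[OF that] .
  ultimately obtain H where H: "|H| \<le>o l" "\<And>A. A \<subseteq> H \<Longrightarrow> |A| <o r \<Longrightarrow> \<Phi> A \<subseteq> H"
    using closing_off[OF r l rl, of \<Phi>] by blast
  have fin: "c \<V> \<in> H" if \<V>: "finite \<V>" "\<V> \<subseteq> (\<Union>x\<in>H \<inter> topspace X. L x)" for \<V>
  proof -
    have "\<forall>V\<in>\<V>. \<exists>x\<in>H \<inter> topspace X. V \<in> L x" using \<V>(2) by blast
    then obtain f where f: "\<And>V. V \<in> \<V> \<Longrightarrow> f V \<in> H \<inter> topspace X \<and> V \<in> L (f V)" by metis
    define A where "A = f ` \<V>"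
    have A: "finite A" "A \<subseteq> H \<inter> topspace X" "\<V> \<subseteq> (\<Union>x\<in>A. L x)"
      using f \<V>(1) by (auto simp: A_def)
    have "\<Phi> A \<subseteq> H" using A card_finite_ordLess[OF r(1)] by (intro H(2)) auto
    moreover have "c \<V> \<in> \<Phi> A" using A \<V>(1) unfolding \<Phi>_def by blast
    ultimately show ?thesis by blast
  qed
  have limH: "lim A \<subseteq> H" if "A \<subseteq> H" "|A| \<le>o \<mu>" for A
    using H(2)[of A] that less_r unfolding \<Phi>_def by blast
  have closed: "closedin X (H \<inter> topspace X)"
  proof -
    have "\<exists>U. openin X U \<and> q \<in> U \<and> U \<subseteq> topspace X - H" if q: "q \<in> topspace X - H" for q
    proof (rule ccontr)
      assume neg: "\<nexists>U. openin X U \<and> q \<in> U \<and> U \<subseteq> topspace X - H"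
      have "\<exists>a. a \<in> V \<inter> H" if "V \<in> L q" for V
      proof -
        have V: "openin X V" "q \<in> V" using L(1)[of q] q that unfolding local_base_def by auto
        then have "\<not> V \<subseteq> topspace X - H" using neg by blast
        then show ?thesis using openin_subset[OF V(1)] by blast
      qed
      then obtain a where a: "\<And>V. V \<in> L q \<Longrightarrow> a V \<in> V \<inter> H" by metis
      have "lim (a ` L q) \<subseteq> H"
        using a ordLeq_transitive[OF card_of_image L(2)[of q]] q by (intro limH) blast+
      moreover have "q \<in> lim (a ` L q)" using q a unfolding lim_def by blast
      ultimately show False using q by blast
    qed
    then have "openin X (topspace X - H)" using openin_subopen[of X "topspace X - H"] by blast
    then show ?thesis
      by (metis Diff_Diff_Int Int_commute closedin_diff closedin_topspace)
  qed
  have "topspace X \<subseteq> H"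
  proof (rule ccontr)
    assume "\<not> topspace X \<subseteq> H"
    then obtain q where q: "q \<in> topspace X" "q \<notin> H" by blast
    have "\<exists>V\<in>L x. q \<notin> V" if "x \<in> H \<inter> topspace X" for x
    proof -
      have x: "x \<in> topspace X" "x \<noteq> q" using that q(2) by auto
      then obtain U W where U: "openin X U" "x \<in> U" "q \<in> W" "disjnt U W"
        using X(2)[unfolded Hausdorff_space_def, rule_format, of x q] q(1) by blast
      then obtain V where "V \<in> L x" "V \<subseteq> U"
        using L(1)[OF x(1)] unfolding local_base_def by blast
      then show ?thesis using U(3,4) unfolding disjnt_iff by blast
    qed
    then obtain V where V: "\<And>x. x \<in> H \<inter> topspace X \<Longrightarrow> V x \<in> L x \<and> q \<notin> V x" by metis
    have "\<exists>\<F>. finite \<F> \<and> \<F> \<subseteq> V ` (H \<inter> topspace X) \<and> H \<inter> topspace X \<subseteq> \<Union>\<F>"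
    proof (rule compactinD)
      show "compactin X (H \<inter> topspace X)" by (rule closedin_compact_space[OF X(1) closed])
      show "openin X U" if "U \<in> V ` (H \<inter> topspace X)" for U
      proof -
        from that obtain x where "x \<in> H \<inter> topspace X" "U = V x" by blast
        then show ?thesis using V[of x] L(1)[of x] unfolding local_base_def by blast
      qed
      show "H \<inter> topspace X \<subseteq> \<Union> (V ` (H \<inter> topspace X))"
      proof
        fix x assume x: "x \<in> H \<inter> topspace X"
        then have "x \<in> V x" using V[OF x] L(1)[of x] unfolding local_base_def by blast
        with x show "x \<in> \<Union> (V ` (H \<inter> topspace X))" by blast
      qed
    qed
    then obtain \<F> where \<F>: "finite \<F>" "\<F> \<subseteq> V ` (H \<inter> topspace X)" "H \<inter> topspace X \<subseteq> \<Union>\<F>" by blast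
    have "q \<in> topspace X - \<Union>\<F>" using q V \<F>(2) by blast
    then have "c \<F> \<in> topspace X - \<Union>\<F>" unfolding c_def by (rule someI)
    moreover have "c \<F> \<in> H" using fin[OF \<F>(1)] \<F>(2) V by blast
    ultimately show False using \<F>(3) by blast
  qed
  then show ?thesis using ordLeq_transitive[OF card_of_mono1 H(1)] unfolding l_def by blast
qed

section \<open>Bases whose elements have few supersets\<close>

lemma local_base_in_base:
  assumes \<B>: "topology_base X \<B>" and L: "local_base X p \<L>" "|\<L>| \<le>o \<mu>"
  obtains \<L>' where "\<L>' \<subseteq> \<B>" "local_base X p \<L>'" "|\<L>'| \<le>o \<mu>"
proof -
  have "\<exists>W\<in>\<B>. p \<in> W \<and> W \<subseteq> V" if "V \<in> \<L>" for V
    using \<B> L(1) that unfolding topology_base_iff local_base_def by metis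
  then obtain W where W: "\<And>V. V \<in> \<L> \<Longrightarrow> W V \<in> \<B> \<and> p \<in> W V \<and> W V \<subseteq> V" by metis
  show ?thesis
  proof (rule that)
    show "W ` \<L> \<subseteq> \<B>" using W by blast
    show "|W ` \<L>| \<le>o \<mu>" by (rule ordLeq_transitive[OF card_of_image L(2)])
    have "openin X (W V)" if "V \<in> \<L>" for V
      using W[OF that] \<B> unfolding topology_base_iff by blast
    moreover have "\<exists>V\<in>\<L>. W V \<subseteq> U" if U: "openin X U" "p \<in> U" for U
    proof -
      obtain V where V: "V \<in> \<L>" "V \<subseteq> U" using L(1) U unfolding local_base_def by blast
      then show ?thesis using W[OF V(1)] by blast
    qed
    ultimately show "local_base X p (W ` \<L>)" using W unfolding local_base_def by simp
  qed
qed

text \<open>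
  Close off a subfamily \<open>M\<close> of \<open>\<B>\<close> under supersets, under local bases at a chosen point \<open>x U\<close> of
  each \<open>U\<close>, and under choosing, for each finite \<open>\<G>\<close>, a nonempty member of \<open>\<B>\<close> disjoint from
  \<open>\<Union>\<G>\<close>. Let \<open>F\<close> be the closed set of points each of whose neighbourhoods contains a member of
  \<open>M\<close>. Closure under supersets puts every basic neighbourhood of a point of \<open>F\<close> into \<open>M\<close>, so it
  suffices that \<open>F\<close> is the whole space. If \<open>q \<notin> F\<close>, then finitely many members of \<open>M\<close> whose
  union misses a neighbourhood of \<open>q\<close> cover the compact set \<open>F\<close>; hence some nonempty
  \<open>U \<in> M\<close> is disjoint from \<open>F\<close>, although \<open>x U \<in> F\<close>.
\<close>
lemma card_of_base_le_character:
  assumes X: "compact_space X" "Hausdorff_space X" and \<mu>: "Cinfinite \<mu>"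
    and lb: "\<And>p. p \<in> topspace X \<Longrightarrow> \<exists>\<L>. local_base X p \<L> \<and> |\<L>| \<le>o \<mu>"
    and \<B>: "topology_base X \<B>"
    and above: "\<And>U. U \<in> \<B> \<Longrightarrow> U \<noteq> {} \<Longrightarrow> |{V \<in> \<B>. U \<subseteq> V}| \<le>o \<mu>"
  shows "|\<B>| \<le>o \<mu>"
proof -
  have op: "openin X U" if "U \<in> \<B>" for U using \<B> that unfolding topology_base_iff by blast
  have nb: "\<exists>V\<in>\<B>. p \<in> V \<and> V \<subseteq> U" if "openin X U" "p \<in> U" for U p
    using \<B> that unfolding topology_base_iff by blast
  have "\<exists>\<L>\<subseteq>\<B>. local_base X p \<L> \<and> |\<L>| \<le>o \<mu>" if p: "p \<in> topspace X" for p
  proof -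
    obtain \<L> where "local_base X p \<L>" "|\<L>| \<le>o \<mu>" using lb[OF p] by blast
    from local_base_in_base[OF \<B> this] show ?thesis by metis
  qed
  then obtain L where L: "\<And>p. p \<in> topspace X \<Longrightarrow> L p \<subseteq> \<B> \<and> local_base X p (L p) \<and> |L p| \<le>o \<mu>"
    by metis
  define x where "x U = (SOME p. p \<in> U)" for U :: "'a set"
  have x: "x U \<in> U \<and> x U \<in> topspace X" if "U \<in> \<B>" "U \<noteq> {}" for U
    using some_in_eq[of U] that(2) openin_subset[OF op[OF that(1)]] unfolding x_def by blast
  define d where "d \<G> = (SOME W. W \<in> \<B> \<and> W \<noteq> {} \<and> W \<inter> \<Union>\<G> = {})" for \<G>
  define \<Phi> where "\<Phi> \<A> = {d \<A>} \<union> (\<Union>U\<in>\<A> \<inter> (\<B> - {{}}). {V \<in> \<B>. U \<subseteq> V} \<union> L (x U))" for \<A>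
  have fin: "|\<A>| <o natLeq \<longleftrightarrow> finite \<A>" for \<A> :: "'a set set"
    using finite_iff_ordLess_natLeq by blast
  have "|\<Phi> \<A>| \<le>o \<mu>" if "|\<A>| <o natLeq" for \<A>
  proof -
    have "|\<A> \<inter> (\<B> - {{}})| \<le>o \<mu>"
      using that card_finite_ordLess[OF \<mu>, of "\<A> \<inter> (\<B> - {{}})"] fin ordLess_imp_ordLeq by blast
    moreover have "|{V \<in> \<B>. U \<subseteq> V} \<union> L (x U)| \<le>o \<mu>" if "U \<in> \<A> \<inter> (\<B> - {{}})" for U
      using that above[of U] L x[of U] by (intro Un_Cinfinite_bound \<mu>) simp_all
    ultimately have "|\<Union>U\<in>\<A> \<inter> (\<B> - {{}}). {V \<in> \<B>. U \<subseteq> V} \<union> L (x U)| \<le>o \<mu>"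
      by (intro UNION_Cinfinite_bound \<mu>) simp_all
    moreover have "|{d \<A>}| \<le>o \<mu>"
      by (intro ordLess_imp_ordLeq card_finite_ordLess \<mu>) simp
    ultimately show ?thesis
      unfolding \<Phi>_def by (intro Un_Cinfinite_bound \<mu>)
  qed
  moreover have "|{\<A>. \<A> \<subseteq> \<S> \<and> |\<A>| <o natLeq}| \<le>o \<mu>" if "|\<S>| \<le>o \<mu>" for \<S> :: "'a set set"
    unfolding fin by (rule card_of_finite_subsets_ordLeq[OF \<mu> that])
  ultimately obtain H where H: "|H| \<le>o \<mu>" "\<And>\<A>. \<A> \<subseteq> H \<Longrightarrow> |\<A>| <o natLeq \<Longrightarrow> \<Phi> \<A> \<subseteq> H"
    using closing_off[OF natLeq_Cinfinite regularCard_natLeq \<mu> natLeq_ordLeq_cinfinite[OF \<mu>], of \<Phi>]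
    by blast
  define M where "M = H \<inter> (\<B> - {{}})"
  have up: "V \<in> M" if "U \<in> M" "V \<in> \<B>" "U \<subseteq> V" for U V
  proof -
    have "\<Phi> {U} \<subseteq> H" using that(1) fin by (intro H(2)) (auto simp: M_def)
    moreover have "V \<in> \<Phi> {U}" using that unfolding \<Phi>_def M_def by blast
    moreover have "V \<noteq> {}" using that unfolding M_def by blast
    ultimately show ?thesis using that(2) unfolding M_def by blast
  qed
  have LM: "L (x U) \<subseteq> M" if "U \<in> M" for U
  proof
    fix V assume V: "V \<in> L (x U)"
    have "\<Phi> {U} \<subseteq> H" using that(1) fin by (intro H(2)) (auto simp: M_def)
    moreover have "V \<in> \<Phi> {U}" using V that unfolding \<Phi>_def M_def by blast
    moreover have "x U \<in> topspace X" using that x[of U] unfolding M_def by blast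
    then have "V \<in> \<B>" "V \<noteq> {}" using L[of "x U"] V unfolding local_base_def by blast+
    ultimately show "V \<in> M" unfolding M_def by blast
  qed
  define F where "F = {p \<in> topspace X. \<forall>G\<in>\<B>. p \<in> G \<longrightarrow> (\<exists>W\<in>M. W \<subseteq> G)}"
  have closed: "closedin X F"
  proof -
    have "\<exists>G. openin X G \<and> p \<in> G \<and> G \<subseteq> topspace X - F" if p: "p \<in> topspace X - F" for p
    proof -
      obtain G where G: "G \<in> \<B>" "p \<in> G" "\<not> (\<exists>W\<in>M. W \<subseteq> G)" using p unfolding F_def by blast
      have "G \<subseteq> topspace X" by (rule openin_subset[OF op[OF G(1)]])
      moreover have "G \<inter> F = {}" using G(1,3) unfolding F_def by blast
      ultimately show ?thesis using G(2) op[OF G(1)] by blast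
    qed
    then have "openin X (topspace X - F)" using openin_subopen[of X "topspace X - F"] by blast
    moreover have "F \<subseteq> topspace X" unfolding F_def by blast
    ultimately show ?thesis unfolding closedin_def by blast
  qed
  have xF: "x U \<in> F" if "U \<in> M" for U
  proof -
    have xU: "x U \<in> topspace X" using that x[of U] unfolding M_def by blast
    have "\<exists>W\<in>M. W \<subseteq> G" if G: "G \<in> \<B>" "x U \<in> G" for G
    proof -
      obtain W where "W \<in> L (x U)" "W \<subseteq> G"
        using L[OF xU] op[OF G(1)] G(2) unfolding local_base_def by blast
      then show ?thesis using LM[OF \<open>U \<in> M\<close>] by blast
    qed
    then show ?thesis using xU unfolding F_def by blast
  qed
  have all: "q \<in> F" if q: "q \<in> topspace X" for q
  proof (rule ccontr)
    assume qF: "q \<notin> F"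
    have "\<exists>G Q. G \<in> M \<and> p \<in> G \<and> openin X Q \<and> q \<in> Q \<and> disjnt G Q" if p: "p \<in> F" for p
    proof -
      have "p \<in> topspace X" "p \<noteq> q" using p qF unfolding F_def by auto
      then obtain P Q where PQ: "openin X P" "openin X Q" "p \<in> P" "q \<in> Q" "disjnt P Q"
        using X(2)[unfolded Hausdorff_space_def, rule_format, of p q] q by blast
      obtain G where G: "G \<in> \<B>" "p \<in> G" "G \<subseteq> P" using nb[OF PQ(1,3)] by blast
      obtain W where W: "W \<in> M" "W \<subseteq> G" using p G unfolding F_def by blast
      have "G \<in> M" by (rule up[OF W(1) G(1) W(2)])
      moreover have "disjnt G Q" using PQ(5) G(3) by (rule disjnt_subset1)
      ultimately show ?thesis using PQ G(2) by blast
    qed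
    then obtain G Q where GQ: "\<And>p. p \<in> F \<Longrightarrow>
        G p \<in> M \<and> p \<in> G p \<and> openin X (Q p) \<and> q \<in> Q p \<and> disjnt (G p) (Q p)" by metis
    have "\<exists>\<F>. finite \<F> \<and> \<F> \<subseteq> G ` F \<and> F \<subseteq> \<Union>\<F>"
    proof (rule compactinD)
      show "compactin X F" by (rule closedin_compact_space[OF X(1) closed])
      show "openin X U" if "U \<in> G ` F" for U
        using that GQ op unfolding M_def by auto
      show "F \<subseteq> \<Union> (G ` F)" using GQ by blast
    qed
    then obtain F0 where F0: "finite F0" "F0 \<subseteq> F" "F \<subseteq> \<Union> (G ` F0)"
      by (metis finite_subset_image)
    define R where "R = topspace X \<inter> \<Inter> (Q ` F0)"
    have "openin X R"
    proof (cases "F0 = {}")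
      case True
      then show ?thesis unfolding R_def by simp
    next
      case False
      then have "openin X (\<Inter> (Q ` F0))" using F0 GQ by (intro openin_Inter) auto
      then show ?thesis unfolding R_def by (intro openin_Int) simp_all
    qed
    moreover have "q \<in> R" using q GQ F0(2) unfolding R_def by blast
    ultimately obtain W where W: "W \<in> \<B>" "q \<in> W" "W \<subseteq> R" using nb by metis
    have "R \<inter> \<Union> (G ` F0) = {}"
    proof -
      have "R \<inter> G p = {}" if "p \<in> F0" for p
        using GQ[of p] F0(2) that unfolding R_def disjnt_def by blast
      then show ?thesis by blast
    qed
    then have "W \<in> \<B> \<and> W \<noteq> {} \<and> W \<inter> \<Union> (G ` F0) = {}" using W by blast
    then have d: "d (G ` F0) \<in> \<B> \<and> d (G ` F0) \<noteq> {} \<and> d (G ` F0) \<inter> \<Union> (G ` F0) = {}"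
      unfolding d_def by (rule someI)
    have "G ` F0 \<subseteq> H" using GQ F0(2) unfolding M_def by blast
    then have "\<Phi> (G ` F0) \<subseteq> H" by (rule H(2)) (simp add: fin F0(1))
    then have "d (G ` F0) \<in> M" using d unfolding \<Phi>_def M_def by blast
    then have "x (d (G ` F0)) \<in> F" by (rule xF)
    moreover have "x (d (G ` F0)) \<in> d (G ` F0)" using d x by blast
    ultimately show False using F0(3) d by blast
  qed
  have "\<B> \<subseteq> {{}} \<union> H"
  proof
    fix U assume U: "U \<in> \<B>"
    show "U \<in> {{}} \<union> H"
    proof (cases "U = {}")
      case False
      then obtain q where q: "q \<in> U" by blast
      then have "q \<in> F" using all openin_subset[OF op[OF U]] by blast
      then obtain W where "W \<in> M" "W \<subseteq> U" using q U unfolding F_def by blast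
      then show ?thesis using up U unfolding M_def by blast
    qed simp
  qed
  moreover have "|{{}} \<union> H| \<le>o \<mu>"
    by (intro Un_Cinfinite_bound H(1) \<mu> ordLess_imp_ordLeq card_finite_ordLess) simp
  ultimately show ?thesis using ordLeq_transitive[OF card_of_mono1] by blast
qed

section \<open>Choosing disjoint finite sets\<close>

text \<open>
  Well-order \<open>I\<close> so that each index has fewer than \<open>\<mu>\<close> predecessors. The finite sets
  chosen for these together have fewer than \<open>\<mu>\<close> elements, so the next choice can avoid them.
\<close>
lemma disjoint_finite_choice:
  assumes \<mu>: "Cinfinite \<mu>" and I: "|I| \<le>o \<mu>"
    and ex: "\<And>i S. i \<in> I \<Longrightarrow> |S| <o \<mu> \<Longrightarrow> \<exists>F. finite F \<and> F \<inter> S = {} \<and> Q i F"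
  shows "\<exists>F. (\<forall>i\<in>I. finite (F i) \<and> Q i (F i)) \<and> (\<forall>i\<in>I. \<forall>j\<in>I. i \<noteq> j \<longrightarrow> F i \<inter> F j = {})"
proof -
  let ?r = "|I|"
  define P where "P f i F \<longleftrightarrow> (i \<in> I \<longrightarrow> finite F \<and> F \<inter> (\<Union>j\<in>underS ?r i. f j) = {} \<and> Q i F)"
    for f i F
  have "\<exists>F. \<forall>i. P F i (F i)"
  proof (rule dependent_wf_choice[where R = "?r - Id"])
    show "wf (?r - Id)"
      using card_of_Well_order[of I] unfolding well_order_on_def by blast
    show "P f i F = P g i F" if "\<And>z. (z, i) \<in> ?r - Id \<Longrightarrow> f z = g z" for f g i F
    proof -
      have "(\<Union>j\<in>underS ?r i. f j) = (\<Union>j\<in>underS ?r i. g j)"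
        using that by (intro SUP_cong) (auto simp: underS_def)
      then show ?thesis unfolding P_def by simp
    qed
    show "\<exists>F. P f i F" if f: "\<And>y. (y, i) \<in> ?r - Id \<Longrightarrow> P f y (f y)" for i f
    proof (cases "i \<in> I")
      case True
      have "|underS ?r i| <o ?r"
        using True by (intro card_of_underS card_of_Card_order) (simp add: Field_card_of)
      then have "|underS ?r i| <o \<mu>" using I by (rule ordLess_ordLeq_trans)
      moreover have "finite (f j)" if "j \<in> underS ?r i" for j
      proof -
        have "(j, i) \<in> ?r - Id" using that unfolding underS_def by blast
        moreover from this have "j \<in> I" using Field_card_of[of I] unfolding Field_def by blast
        ultimately show ?thesis using f unfolding P_def by blast
      qed
      ultimately have "|\<Union>j\<in>underS ?r i. f j| <o \<mu>" by (rule UN_finite_ordLess[OF \<mu>])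
      from ex[OF True this] show ?thesis unfolding P_def by blast
    qed (simp add: P_def)
  qed
  then obtain F where F: "\<And>i. P F i (F i)" by blast
  have lt: "F i \<inter> F j = {}" if "i \<in> I" "j \<in> underS ?r i" for i j
    using F[of i] that unfolding P_def by blast
  show ?thesis
  proof (intro exI[of _ F] conjI ballI impI)
    show "finite (F i)" "Q i (F i)" if "i \<in> I" for i
      using F[of i] that unfolding P_def by blast+
    show "F i \<inter> F j = {}" if "i \<in> I" "j \<in> I" "i \<noteq> j" for i j
    proof -
      have "total_on I ?r"
        using card_of_Well_order[of I] Field_card_of[of I]
        unfolding well_order_on_def linear_order_on_def by simp
      then have "(i, j) \<in> ?r \<or> (j, i) \<in> ?r" using that unfolding total_on_def by blast
      then have "i \<in> underS ?r j \<or> j \<in> underS ?r i" using that(3) unfolding underS_def by blast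
      then show ?thesis using lt that by blast
    qed
  qed
qed

section \<open>Powers and their diagonals\<close>

lemma openin_power_contains_cube:
  assumes G: "openin (product_topology (\<lambda>_. X) I) G" "(\<lambda>i\<in>I. p) \<in> G" and I: "finite I" "I \<noteq> {}"
  obtains Z where "openin X Z" "p \<in> Z" "Pi\<^sub>E I (\<lambda>_. Z) \<subseteq> G"
proof -
  obtain U where U: "\<forall>i\<in>I. openin X (U i)" "(\<lambda>i\<in>I. p) \<in> Pi\<^sub>E I U" "Pi\<^sub>E I U \<subseteq> G"
    using G unfolding openin_product_topology_alt by blast
  show ?thesis
  proof
    show "openin X (\<Inter>i\<in>I. U i)" using I U(1) by (intro openin_Inter) auto
    have "p \<in> U i" if "i \<in> I" for i
      using PiE_mem[OF U(2), of i] that by simp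
    then show "p \<in> (\<Inter>i\<in>I. U i)" by blast
    have "Pi\<^sub>E I (\<lambda>_. \<Inter>i\<in>I. U i) \<subseteq> Pi\<^sub>E I U" by (intro PiE_mono) blast
    with U(3) show "Pi\<^sub>E I (\<lambda>_. \<Inter>i\<in>I. U i) \<subseteq> G" by blast
  qed
qed

lemma diagonal_in_cube_iff:
  "I \<noteq> {} \<Longrightarrow> (\<lambda>i\<in>I. p) \<in> Pi\<^sub>E I (\<lambda>_. U) \<longleftrightarrow> p \<in> U"
  by (auto simp: restrict_PiE_iff)

lemma cube_subset_iff:
  assumes "I \<noteq> {}"
  shows "Pi\<^sub>E I (\<lambda>_. U) \<subseteq> Pi\<^sub>E I (\<lambda>_. V) \<longleftrightarrow> U \<subseteq> V"
proof
  assume sub: "Pi\<^sub>E I (\<lambda>_. U) \<subseteq> Pi\<^sub>E I (\<lambda>_. V)"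
  show "U \<subseteq> V"
  proof
    fix p assume "p \<in> U"
    then show "p \<in> V"
      using sub diagonal_in_cube_iff[OF assms, of p U] diagonal_in_cube_iff[OF assms, of p V] by blast
  qed
qed (intro PiE_mono, blast)

lemma openin_cube:
  "finite I \<Longrightarrow> openin X U \<Longrightarrow> openin (product_topology (\<lambda>_. X) I) (Pi\<^sub>E I (\<lambda>_. U))"
  by (subst openin_PiE) auto

lemma openin_diagonal_preimage:
  assumes G: "openin (product_topology (\<lambda>_. X) I) G" and I: "finite I" "I \<noteq> {}"
  shows "openin X {p \<in> topspace X. (\<lambda>i\<in>I. p) \<in> G}"
proof (subst openin_subopen, intro ballI)
  fix p assume p: "p \<in> {p \<in> topspace X. (\<lambda>i\<in>I. p) \<in> G}"
  then obtain Z where Z: "openin X Z" "p \<in> Z" "Pi\<^sub>E I (\<lambda>_. Z) \<subseteq> G"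
    using openin_power_contains_cube[OF G _ I] by blast
  have "(\<lambda>i\<in>I. q) \<in> G" if "q \<in> Z" for q
    using Z(3) that by (intro subsetD[OF Z(3)]) simp
  then have "Z \<subseteq> {p \<in> topspace X. (\<lambda>i\<in>I. p) \<in> G}"
    using openin_subset[OF Z(1)] by blast
  with Z show "\<exists>T. openin X T \<and> p \<in> T \<and> T \<subseteq> {p \<in> topspace X. (\<lambda>i\<in>I. p) \<in> G}" by blast
qed

lemma topology_base_diagonal:
  assumes \<B>: "topology_base (product_topology (\<lambda>_. X) I) \<B>" and I: "finite I" "I \<noteq> {}"
  shows "topology_base X ((\<lambda>G. {p \<in> topspace X. (\<lambda>i\<in>I. p) \<in> G}) ` \<B>)"
  unfolding topology_base_iff
proof (intro conjI allI impI ballI)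
  show "openin X V" if "V \<in> (\<lambda>G. {p \<in> topspace X. (\<lambda>i\<in>I. p) \<in> G}) ` \<B>" for V
  proof -
    from that obtain G where G: "G \<in> \<B>" "V = {p \<in> topspace X. (\<lambda>i\<in>I. p) \<in> G}" by blast
    have "openin (product_topology (\<lambda>_. X) I) G"
      using \<B> G(1) unfolding topology_base_iff by blast
    then show ?thesis unfolding G(2) by (rule openin_diagonal_preimage[OF _ I])
  qed
  fix U p assume U: "openin X U \<and> p \<in> U"
  then have "openin (product_topology (\<lambda>_. X) I) (Pi\<^sub>E I (\<lambda>_. U))" using I(1) by (simp add: openin_cube)
  moreover have "(\<lambda>i\<in>I. p) \<in> Pi\<^sub>E I (\<lambda>_. U)" using U by simp
  ultimately obtain G where G: "G \<in> \<B>" "(\<lambda>i\<in>I. p) \<in> G" "G \<subseteq> Pi\<^sub>E I (\<lambda>_. U)"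
    using \<B> unfolding topology_base_iff by metis
  have "q \<in> U" if "(\<lambda>i\<in>I. q) \<in> G" for q
    using subsetD[OF G(3) that] unfolding diagonal_in_cube_iff[OF I(2)] by simp
  moreover have "p \<in> topspace X" using U openin_subset by blast
  ultimately show "\<exists>V\<in>(\<lambda>G. {p \<in> topspace X. (\<lambda>i\<in>I. p) \<in> G}) ` \<B>. p \<in> V \<and> V \<subseteq> U"
    using G(1,2) by (intro bexI[of _ "{p \<in> topspace X. (\<lambda>i\<in>I. p) \<in> G}"]) auto
qed

text \<open>
  The neighbourhoods from \<open>\<B>\<close> that lie in a fixed cube around a diagonal point are already enough
  to trace out a local base on the diagonal. So there are at least as many of them as the character
  of the point in the factor.
\<close>
lemma local_base_diagonal:
  assumes \<B>: "topology_base (product_topology (\<lambda>_. X) I) \<B>" and I: "finite I" "I \<noteq> {}"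
    and V: "openin X V" "p \<in> V"
  shows "local_base X p ((\<lambda>G. {q \<in> topspace X. (\<lambda>i\<in>I. q) \<in> G}) `
           {G \<in> \<B>. (\<lambda>i\<in>I. p) \<in> G \<and> G \<subseteq> Pi\<^sub>E I (\<lambda>_. V)})"
  unfolding local_base_def
proof (intro conjI allI impI ballI)
  let ?d = "\<lambda>G. {q \<in> topspace X. (\<lambda>i\<in>I. q) \<in> G}"
  let ?G = "{G \<in> \<B>. (\<lambda>i\<in>I. p) \<in> G \<and> G \<subseteq> Pi\<^sub>E I (\<lambda>_. V)}"
  have pX: "p \<in> topspace X" using V openin_subset by blast
  fix W assume "W \<in> ?d ` ?G"
  then obtain G where G: "G \<in> ?G" "W = ?d G" by blast
  have "openin (product_topology (\<lambda>_. X) I) G"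
    using \<B> G(1) unfolding topology_base_iff by blast
  then show "openin X W" unfolding G(2) by (rule openin_diagonal_preimage[OF _ I])
  show "p \<in> W" using G pX by blast
next
  let ?d = "\<lambda>G. {q \<in> topspace X. (\<lambda>i\<in>I. q) \<in> G}"
  let ?G = "{G \<in> \<B>. (\<lambda>i\<in>I. p) \<in> G \<and> G \<subseteq> Pi\<^sub>E I (\<lambda>_. V)}"
  fix U assume U: "openin X U \<and> p \<in> U"
  then have "openin (product_topology (\<lambda>_. X) I) (Pi\<^sub>E I (\<lambda>_. U \<inter> V))"
    using V by (intro openin_cube I(1) openin_Int) simp_all
  moreover have "(\<lambda>i\<in>I. p) \<in> Pi\<^sub>E I (\<lambda>_. U \<inter> V)" using U V by (simp add: diagonal_in_cube_iff[OF I(2)])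
  ultimately obtain G where G: "G \<in> \<B>" "(\<lambda>i\<in>I. p) \<in> G" "G \<subseteq> Pi\<^sub>E I (\<lambda>_. U \<inter> V)"
    using \<B> unfolding topology_base_iff by metis
  have "q \<in> U" if "(\<lambda>i\<in>I. q) \<in> G" for q
    using subsetD[OF G(3) that] unfolding diagonal_in_cube_iff[OF I(2)] by simp
  then have "?d G \<subseteq> U" by blast
  moreover have "G \<subseteq> Pi\<^sub>E I (\<lambda>_. V)" by (rule subset_trans[OF G(3)], rule PiE_mono) simp
  then have "G \<in> ?G" using G by simp
  ultimately show "\<exists>W\<in>?d ` ?G. W \<subseteq> U" by blast
qed

section \<open>Passing between a space and its powers\<close>

text \<open>
  \<open>J\<close> lists the pairs of nested basic sets with a closed set between them. A set \<open>R\<close> is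
  \<open>good\<close> for such a pair if it is a finite list of sets \<open>Z\<close> covering the smaller one, each with
  a witness \<open>G \<in> \<B>\<close> between the cube of \<open>Z\<close> and the cube of the larger one. The witness sets for
  different pairs are chosen disjoint, so \<open>G\<close> recovers the pair and hence \<open>Z\<close> up to
  finitely many possibilities. This is what transfers op-likeness from \<open>\<B>\<close> to the sets \<open>Z\<close>.
\<close>
lemma op_like_base_from_power:
  assumes X: "compact_space X" "Hausdorff_space X" and I: "finite I" "I \<noteq> {}"
    and \<mu>: "Cinfinite \<mu>" and \<E>: "topology_base X \<E>" "|\<E>| \<le>o \<mu>"
    and char: "\<And>p \<L>. p \<in> topspace X \<Longrightarrow> local_base X p \<L> \<Longrightarrow> \<mu> \<le>o |\<L>|"
    and \<kappa>: "Cinfinite \<kappa>" and pow: "has_op_like_base (product_topology (\<lambda>_. X) I) \<kappa>"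
  shows "has_op_like_base X \<kappa>"
proof -
  let ?Y = "product_topology (\<lambda>_. X) I"
  let ?cube = "\<lambda>Z. Pi\<^sub>E I (\<lambda>_. Z)"
  obtain \<B> where \<B>: "topology_base ?Y \<B>" "op_like \<kappa> \<B>"
    using pow unfolding has_op_like_base_def by blast
  define J where "J = {(U, V). U \<in> \<E> \<and> V \<in> \<E> \<and> (\<exists>C. closedin X C \<and> U \<subseteq> C \<and> C \<subseteq> V)}"
  define good where "good i R \<longleftrightarrow> finite R \<and> fst i \<subseteq> (\<Union>(Z, G)\<in>R. Z) \<and>
      (\<forall>(Z, G)\<in>R. openin X Z \<and> Z \<noteq> {} \<and> ?cube Z \<subseteq> G \<and> G \<in> \<B> \<and> G \<subseteq> ?cube (snd i))"
    for i :: "'a set \<times> 'a set" and R :: "('a set \<times> ('b \<Rightarrow> 'a) set) set"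
  define Q where "Q i F \<longleftrightarrow> (\<exists>R. good i R \<and> snd ` R \<subseteq> F)" for i F
  have J: "|J| \<le>o \<mu>"
  proof -
    have "|\<E> \<times> \<E>| \<le>o \<mu>"
      using \<mu> \<E>(2) unfolding cinfinite_def by (intro card_of_Times_ordLeq_infinite_Field) simp_all
    moreover have "J \<subseteq> \<E> \<times> \<E>" unfolding J_def by blast
    ultimately show ?thesis using ordLeq_transitive[OF card_of_mono1] by blast
  qed
  have step: "\<exists>F. finite F \<and> F \<inter> S = {} \<and> Q i F" if i: "i \<in> J" and S: "|S| <o \<mu>" for i S
  proof -
    obtain U V C where UV: "i = (U, V)" "U \<in> \<E>" "V \<in> \<E>" "closedin X C" "U \<subseteq> C" "C \<subseteq> V"
      using i unfolding J_def by blast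
    have V: "openin X V" using \<E>(1) UV(3) unfolding topology_base_iff by blast
    have "\<exists>Z G. openin X Z \<and> p \<in> Z \<and> ?cube Z \<subseteq> G \<and> G \<in> \<B> - S \<and> G \<subseteq> ?cube V" if p: "p \<in> C" for p
    proof -
      let ?G = "{G \<in> \<B>. (\<lambda>i\<in>I. p) \<in> G \<and> G \<subseteq> ?cube V}"
      let ?d = "\<lambda>G. {q \<in> topspace X. (\<lambda>i\<in>I. q) \<in> G}"
      have pV: "p \<in> V" "p \<in> topspace X" using p UV(6) openin_subset[OF V] by auto
      \<comment> \<open>Fewer than \<open>\<mu>\<close> used sets cannot exhaust a family that traces out a local base.\<close>
      have "\<not> ?G \<subseteq> S"
      proof
        assume sub: "?G \<subseteq> S"
        have "\<mu> \<le>o |?d ` ?G|"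
          by (rule char[OF pV(2) local_base_diagonal[OF \<B>(1) I V pV(1)]])
        also have "|?d ` ?G| \<le>o |?G|" by (rule card_of_image)
        also have "|?G| \<le>o |S|" by (rule card_of_mono1[OF sub])
        also have "|S| <o \<mu>" by (rule S)
        finally show False using ordLess_irreflexive by blast
      qed
      then obtain G where G: "G \<in> \<B> - S" "(\<lambda>i\<in>I. p) \<in> G" "G \<subseteq> ?cube V" by blast
      have "openin ?Y G" using \<B>(1) G(1) unfolding topology_base_iff by blast
      then obtain Z where "openin X Z" "p \<in> Z" "?cube Z \<subseteq> G"
        using openin_power_contains_cube[OF _ G(2) I] by blast
      with G show ?thesis by blast
    qed
    then obtain Z G where ZG: "\<And>p. p \<in> C \<Longrightarrow>
        openin X (Z p) \<and> p \<in> Z p \<and> ?cube (Z p) \<subseteq> G p \<and> G p \<in> \<B> - S \<and> G p \<subseteq> ?cube V" by metis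
    have "\<exists>\<F>. finite \<F> \<and> \<F> \<subseteq> Z ` C \<and> C \<subseteq> \<Union>\<F>"
    proof (rule compactinD)
      show "compactin X C" by (rule closedin_compact_space[OF X(1) UV(4)])
      show "openin X W" if "W \<in> Z ` C" for W using that ZG by blast
      show "C \<subseteq> \<Union> (Z ` C)" using ZG by blast
    qed
    then obtain C0 where C0: "finite C0" "C0 \<subseteq> C" "C \<subseteq> \<Union> (Z ` C0)"
      by (metis finite_subset_image)
    have "good i ((\<lambda>p. (Z p, G p)) ` C0)"
    proof -
      have "fst i \<subseteq> (\<Union>(Z, G)\<in>(\<lambda>p. (Z p, G p)) ` C0. Z)" using C0(3) UV(1,5) by auto
      moreover have "openin X (Z p) \<and> Z p \<noteq> {} \<and> ?cube (Z p) \<subseteq> G p \<and> G p \<in> \<B> \<and> G p \<subseteq> ?cube (snd i)"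
        if "p \<in> C0" for p
        using ZG[of p] that C0(2) UV(1) by auto
      ultimately show ?thesis unfolding good_def using C0(1) by blast
    qed
    moreover have "snd ` (\<lambda>p. (Z p, G p)) ` C0 = G ` C0" by (simp add: image_image)
    ultimately have "Q i (G ` C0)" unfolding Q_def by blast
    moreover have "G ` C0 \<inter> S = {}" using ZG C0(2) by blast
    ultimately show ?thesis using C0(1) by blast
  qed
  have "\<exists>F. (\<forall>i\<in>J. finite (F i) \<and> Q i (F i)) \<and> (\<forall>i\<in>J. \<forall>j\<in>J. i \<noteq> j \<longrightarrow> F i \<inter> F j = {})"
    by (rule disjoint_finite_choice[OF \<mu> J]) (rule step)
  then obtain F where F: "\<And>i. i \<in> J \<Longrightarrow> finite (F i) \<and> Q i (F i)"
    "\<And>i j. i \<in> J \<Longrightarrow> j \<in> J \<Longrightarrow> i \<noteq> j \<Longrightarrow> F i \<inter> F j = {}"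
    by metis
  have "\<forall>i\<in>J. \<exists>R. good i R \<and> snd ` R \<subseteq> F i"
    using F(1) unfolding Q_def by simp
  from bchoice[OF this] obtain R where R_all: "\<forall>i\<in>J. good i (R i) \<and> snd ` R i \<subseteq> F i" ..
  have R: "good i (R i) \<and> snd ` R i \<subseteq> F i" if "i \<in> J" for i
    by (rule bspec[OF R_all that])
  have RD: "openin X Z" "Z \<noteq> {}" "?cube Z \<subseteq> G" "G \<in> \<B>" "G \<subseteq> ?cube (snd i)" "G \<in> F i"
    if "i \<in> J" "(Z, G) \<in> R i" for i Z G
  proof -
    have "\<forall>(Z, G)\<in>R i. openin X Z \<and> Z \<noteq> {} \<and> ?cube Z \<subseteq> G \<and> G \<in> \<B> \<and> G \<subseteq> ?cube (snd i)"
      using R[OF that(1)] unfolding good_def by (elim conjE)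
    from bspec[OF this that(2)]
    show "openin X Z" "Z \<noteq> {}" "?cube Z \<subseteq> G" "G \<in> \<B>" "G \<subseteq> ?cube (snd i)" by simp_all
    show "G \<in> F i" using R[OF that(1)] imageI[OF that(2), of snd] by auto
  qed
  define \<D> where "\<D> = (\<Union>i\<in>J. fst ` R i)"
  have \<D>E: "\<exists>i\<in>J. \<exists>G. (Z, G) \<in> R i" if "Z \<in> \<D>" for Z using that unfolding \<D>_def by force
  have "topology_base X \<D>"
    unfolding topology_base_iff
  proof (intro conjI ballI allI impI)
    show "openin X Z" if "Z \<in> \<D>" for Z using \<D>E[OF that] RD(1) by blast
    fix W p assume W: "openin X W \<and> p \<in> W"
    then obtain V where V: "V \<in> \<E>" "p \<in> V" "V \<subseteq> W"
      using \<E>(1) unfolding topology_base_iff by metis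
    have "neighbourhood_base_of (closedin X) X"
      unfolding neighbourhood_base_of_closedin by (rule compact_Hausdorff_imp_regular_space[OF X])
    moreover have "openin X V" using \<E>(1) V(1) unfolding topology_base_iff by blast
    ultimately obtain U' C where U': "openin X U'" "closedin X C" "p \<in> U'" "U' \<subseteq> C" "C \<subseteq> V"
      using V(2) unfolding neighbourhood_base_of by metis
    then obtain U where U: "U \<in> \<E>" "p \<in> U" "U \<subseteq> U'"
      using \<E>(1) unfolding topology_base_iff by metis
    have UV: "(U, V) \<in> J" using U(1,3) V(1) U'(2,4,5) unfolding J_def by blast
    have "U \<subseteq> (\<Union>(Z, G)\<in>R (U, V). Z)" using R[OF UV] unfolding good_def fst_conv by (elim conjE)
    then obtain Z G where ZG: "(Z, G) \<in> R (U, V)" "p \<in> Z" using U(2) by blast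
    have "?cube Z \<subseteq> ?cube V" using RD(3,5)[OF UV ZG(1)] by simp
    then have "Z \<subseteq> V" by (simp add: cube_subset_iff[OF I(2)])
    moreover have "Z \<in> \<D>" using UV ZG(1) unfolding \<D>_def by force
    ultimately show "\<exists>Z\<in>\<D>. p \<in> Z \<and> Z \<subseteq> W" using ZG(2) V(3) by blast
  qed
  moreover have "|{Z \<in> \<D>. W \<subseteq> Z}| <o \<kappa>" if W: "W \<in> \<D>" for W
  proof -
    obtain i H where i: "i \<in> J" "(W, H) \<in> R i" using \<D>E[OF W] by blast
    obtain p where p: "p \<in> W" using RD(2)[OF i] by blast
    have "openin ?Y (?cube W)" by (rule openin_cube[OF I(1) RD(1)[OF i]])
    moreover have "(\<lambda>i\<in>I. p) \<in> ?cube W" using p by simp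
    ultimately obtain b where b: "b \<in> \<B>" "b \<subseteq> ?cube W"
      using \<B>(1) unfolding topology_base_iff by metis
    define T where "T G = {Z. \<exists>j\<in>J. (Z, G) \<in> R j}" for G
    have "finite (T G)" for G
    proof (cases "\<exists>j\<in>J. G \<in> F j")
      case True
      then obtain j where j: "j \<in> J" "G \<in> F j" by blast
      have "T G \<subseteq> fst ` R j"
      proof
        fix Z assume "Z \<in> T G"
        then obtain k where k: "k \<in> J" "(Z, G) \<in> R k" unfolding T_def by blast
        then have "k = j" using RD(6)[OF k] j F(2)[OF k(1) j(1)] by blast
        then show "Z \<in> fst ` R j" using k(2) by force
      qed
      moreover have "finite (R j)" using R[OF j(1)] unfolding good_def by (elim conjE)
      ultimately show ?thesis using finite_subset finite_imageI by blast
    next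
      case False
      then have "T G = {}" using RD(6) unfolding T_def by blast
      then show ?thesis by simp
    qed
    then have "|\<Union>G\<in>{G \<in> \<B>. b \<subseteq> G}. T G| <o \<kappa>"
      using \<B>(2) b(1) unfolding op_like_def by (intro UN_finite_ordLess[OF \<kappa>]) auto
    moreover have "{Z \<in> \<D>. W \<subseteq> Z} \<subseteq> (\<Union>G\<in>{G \<in> \<B>. b \<subseteq> G}. T G)"
    proof clarify
      fix Z assume Z: "Z \<in> \<D>" "W \<subseteq> Z"
      obtain j G where j: "j \<in> J" "(Z, G) \<in> R j" using \<D>E[OF Z(1)] by blast
      have "?cube W \<subseteq> ?cube Z" using Z(2) by (intro PiE_mono)
      then have "b \<subseteq> G" using b(2) RD(3)[OF j] by blast
      then show "Z \<in> (\<Union>G\<in>{G \<in> \<B>. b \<subseteq> G}. T G)"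
        using RD(4)[OF j] j unfolding T_def by blast
    qed
    ultimately show ?thesis using ordLeq_ordLess_trans[OF card_of_mono1] by blast
  qed
  ultimately show ?thesis unfolding has_op_like_base_def op_like_def by blast
qed

lemma power_op_like_base:
  assumes I: "finite I" and \<kappa>: "Cinfinite \<kappa>" and X: "has_op_like_base X \<kappa>"
  shows "has_op_like_base (product_topology (\<lambda>_. X) I) \<kappa>"
proof -
  obtain \<B> where \<B>: "topology_base X \<B>" "op_like \<kappa> \<B>"
    using X unfolding has_op_like_base_def by blast
  \<comment> \<open>An empty side would make the box empty, and the empty set lies below every box.\<close>
  define \<C> where "\<C> = {Pi\<^sub>E I U |U. \<forall>i\<in>I. U i \<in> \<B> - {{}}}"
  have "topology_base (product_topology (\<lambda>_. X) I) \<C>"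
    unfolding topology_base_iff
  proof (intro conjI ballI allI impI)
    fix W assume "W \<in> \<C>"
    then obtain U where U: "W = Pi\<^sub>E I U" "\<forall>i\<in>I. U i \<in> \<B> - {{}}" unfolding \<C>_def by blast
    have "\<forall>i\<in>I. openin X (U i)" using U(2) \<B>(1) unfolding topology_base_iff by blast
    then show "openin (product_topology (\<lambda>_. X) I) W"
      unfolding U(1) by (simp add: openin_PiE[OF I])
  next
    fix W y assume W: "openin (product_topology (\<lambda>_. X) I) W \<and> y \<in> W"
    then obtain U where U: "\<forall>i\<in>I. openin X (U i)" "y \<in> Pi\<^sub>E I U" "Pi\<^sub>E I U \<subseteq> W"
      unfolding openin_product_topology_alt by blast
    have "\<exists>V\<in>\<B>. y i \<in> V \<and> V \<subseteq> U i" if "i \<in> I" for i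
      using \<B>(1) U(1) PiE_mem[OF U(2) that] that unfolding topology_base_iff by blast
    then obtain V where V: "\<And>i. i \<in> I \<Longrightarrow> V i \<in> \<B> \<and> y i \<in> V i \<and> V i \<subseteq> U i" by metis
    have "y \<in> Pi\<^sub>E I V" using V U(2) by (simp add: PiE_iff)
    moreover have "Pi\<^sub>E I V \<subseteq> W" using V PiE_mono[of I V U] U(3) by blast
    moreover have "Pi\<^sub>E I V \<in> \<C>" using V unfolding \<C>_def by blast
    ultimately show "\<exists>V\<in>\<C>. y \<in> V \<and> V \<subseteq> W" by blast
  qed
  moreover have "|{W \<in> \<C>. Pi\<^sub>E I U \<subseteq> W}| <o \<kappa>" if U: "\<forall>i\<in>I. U i \<in> \<B> - {{}}" for U
  proof -
    have "{W \<in> \<C>. Pi\<^sub>E I U \<subseteq> W} \<subseteq> Pi\<^sub>E I ` (Pi\<^sub>E I (\<lambda>i. {V \<in> \<B>. U i \<subseteq> V}))"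
    proof
      fix W assume "W \<in> {W \<in> \<C>. Pi\<^sub>E I U \<subseteq> W}"
      then obtain V where V: "W = Pi\<^sub>E I V" "\<forall>i\<in>I. V i \<in> \<B> - {{}}" "Pi\<^sub>E I U \<subseteq> Pi\<^sub>E I V"
        unfolding \<C>_def by blast
      have "Pi\<^sub>E I U \<noteq> {}" using U by (simp add: PiE_eq_empty_iff)
      then have "\<forall>i\<in>I. U i \<subseteq> V i" using V(3) subset_PiE[of I U V] by blast
      then have "restrict V I \<in> Pi\<^sub>E I (\<lambda>i. {V \<in> \<B>. U i \<subseteq> V})" using V(2) by simp
      moreover have "W = Pi\<^sub>E I (restrict V I)" unfolding V(1) by (intro PiE_cong) simp
      ultimately show "W \<in> Pi\<^sub>E I ` (Pi\<^sub>E I (\<lambda>i. {V \<in> \<B>. U i \<subseteq> V}))" by blast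
    qed
    moreover have "|Pi\<^sub>E I (\<lambda>i. {V \<in> \<B>. U i \<subseteq> V})| <o \<kappa>"
      using \<B>(2) U unfolding op_like_def by (intro card_of_PiE_ordLess \<kappa> I) blast
    ultimately show ?thesis
      using ordLeq_ordLess_trans[OF ordLeq_transitive[OF card_of_mono1 card_of_image]] by blast
  qed
  then have "op_like \<kappa> \<C>" unfolding op_like_def \<C>_def by blast
  ultimately show ?thesis unfolding has_op_like_base_def by blast
qed

lemma local_base_power:
  assumes I: "finite I" and \<mu>: "Cinfinite \<mu>"
    and lb: "\<And>p. p \<in> topspace X \<Longrightarrow> \<exists>\<L>. local_base X p \<L> \<and> |\<L>| \<le>o \<mu>"
    and y: "y \<in> topspace (product_topology (\<lambda>_. X) I)"
  shows "\<exists>\<L>. local_base (product_topology (\<lambda>_. X) I) y \<L> \<and> |\<L>| \<le>o \<mu>"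
proof -
  have y': "y \<in> Pi\<^sub>E I (\<lambda>_. topspace X)" using y by simp
  have "\<exists>\<L>. local_base X (y i) \<L> \<and> |\<L>| \<le>o \<mu>" if "i \<in> I" for i
    by (rule lb[OF PiE_mem[OF y' that]])
  then obtain L where L: "\<And>i. i \<in> I \<Longrightarrow> local_base X (y i) (L i) \<and> |L i| \<le>o \<mu>" by metis
  have "local_base (product_topology (\<lambda>_. X) I) y (Pi\<^sub>E I ` Pi\<^sub>E I L)"
    unfolding local_base_def
  proof (intro conjI ballI allI impI)
    fix W assume "W \<in> Pi\<^sub>E I ` Pi\<^sub>E I L"
    then obtain V where V: "W = Pi\<^sub>E I V" "V \<in> Pi\<^sub>E I L" by blast
    have Vi: "openin X (V i) \<and> y i \<in> V i" if "i \<in> I" for i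
      using PiE_mem[OF V(2) that] L[OF that] unfolding local_base_def by blast
    then show "openin (product_topology (\<lambda>_. X) I) W" unfolding V(1) by (simp add: openin_PiE[OF I])
    show "y \<in> W" using Vi y' unfolding V(1) by (simp add: PiE_iff)
  next
    fix W assume W: "openin (product_topology (\<lambda>_. X) I) W \<and> y \<in> W"
    then obtain U where U: "\<forall>i\<in>I. openin X (U i)" "y \<in> Pi\<^sub>E I U" "Pi\<^sub>E I U \<subseteq> W"
      unfolding openin_product_topology_alt by blast
    have "\<exists>V\<in>L i. V \<subseteq> U i" if "i \<in> I" for i
      using U(1) PiE_mem[OF U(2) that] L[OF that] that unfolding local_base_def by blast
    then obtain V where V: "\<And>i. i \<in> I \<Longrightarrow> V i \<in> L i \<and> V i \<subseteq> U i" by metis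
    have "Pi\<^sub>E I (restrict V I) \<subseteq> W" using V PiE_mono[of I "restrict V I" U] U(3) by auto
    moreover have "restrict V I \<in> Pi\<^sub>E I L" using V by simp
    ultimately show "\<exists>V\<in>Pi\<^sub>E I ` Pi\<^sub>E I L. V \<subseteq> W" by blast
  qed
  moreover have "|Pi\<^sub>E I ` Pi\<^sub>E I L| \<le>o \<mu>"
    using L by (intro ordLeq_transitive[OF card_of_image] card_of_PiE_ordLeq \<mu> I) blast
  ultimately show ?thesis by blast
qed

lemma local_base_homeomorphic_image:
  assumes f: "homeomorphic_map X Y f" and L: "local_base X p \<L>" and p: "p \<in> topspace X"
  shows "local_base Y (f p) ((`) f ` \<L>)"
  unfolding local_base_def
proof (intro conjI ballI allI impI)
  fix W assume "W \<in> (`) f ` \<L>"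
  then obtain V where V: "W = f ` V" "V \<in> \<L>" by blast
  have oV: "openin X V" "p \<in> V" using L V(2) unfolding local_base_def by auto
  show "openin Y W"
    unfolding V(1) using homeomorphic_map_openness[OF f openin_subset[OF oV(1)]] oV(1) by simp
  show "f p \<in> W" using oV(2) V(1) by blast
next
  fix U assume U: "openin Y U \<and> f p \<in> U"
  have "continuous_map X Y f" by (rule homeomorphic_imp_continuous_map[OF f])
  then have "openin X {x \<in> topspace X. f x \<in> U}"
    using U openin_continuous_map_preimage by blast
  then obtain V where "V \<in> \<L>" "V \<subseteq> {x \<in> topspace X. f x \<in> U}"
    using L p U unfolding local_base_def by blast
  then show "\<exists>W\<in>(`) f ` \<L>. W \<subseteq> U" by blast
qed

lemma finite_local_base_imp_open_singleton:
  assumes X: "Hausdorff_space X" and p: "p \<in> topspace X" and L: "local_base X p \<L>" "finite \<L>"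
  shows "openin X {p}"
proof -
  have ne: "\<L> \<noteq> {}" using L(1) p openin_topspace[of X] unfolding local_base_def by blast
  have "openin X (\<Inter>\<L>)" using L ne unfolding local_base_def by (intro openin_Inter) auto
  moreover have "\<Inter>\<L> = {p}"
  proof
    show "{p} \<subseteq> \<Inter>\<L>" using L(1) unfolding local_base_def by blast
    show "\<Inter>\<L> \<subseteq> {p}"
    proof (rule subsetI, rule ccontr)
      fix q assume q: "q \<in> \<Inter>\<L>" "q \<notin> {p}"
      have "q \<in> topspace X" using q(1) ne L(1) openin_subset unfolding local_base_def by blast
      then obtain U V where UV: "openin X U" "p \<in> U" "q \<in> V" "disjnt U V"
        using X[unfolded Hausdorff_space_def, rule_format, of p q] p q(2) by auto
      obtain W where "W \<in> \<L>" "W \<subseteq> U" using L(1) UV(1,2) unfolding local_base_def by blast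
      then show False using q(1) UV(3,4) unfolding disjnt_iff by blast
    qed
  qed
  ultimately show ?thesis by simp
qed

section \<open>Homogeneous compact spaces\<close>

text \<open>
  Homeomorphisms carry a smallest local base to all other points. It is infinite, since a finite one
  would make its point isolated; then all points would be isolated, and a compact discrete
  space is finite.
\<close>
lemma character_exists:
  fixes X :: "'a topology"
  assumes X: "homogeneous_space X" "Hausdorff_space X" "compact_space X" "infinite (topspace X)"
  obtains \<mu> :: "'a set rel" where "Cinfinite \<mu>"
    "\<And>p. p \<in> topspace X \<Longrightarrow> \<exists>\<L>. local_base X p \<L> \<and> |\<L>| \<le>o \<mu>"
    "\<And>p \<L>. p \<in> topspace X \<Longrightarrow> local_base X p \<L> \<Longrightarrow> \<mu> \<le>o |\<L>|"
proof -
  obtain p where p: "p \<in> topspace X" using X(4) infinite_imp_nonempty by blast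
  have "local_base X p {U. openin X U \<and> p \<in> U}" unfolding local_base_def by blast
  then have "\<exists>r\<in>card_of ` {\<L>. local_base X p \<L>}. \<forall>r'\<in>card_of ` {\<L>. local_base X p \<L>}. r \<le>o r'"
    by (intro exists_minim_Card_order) (auto simp: card_of_Card_order)
  then obtain \<L> where L: "local_base X p \<L>" "\<And>\<L>'. local_base X p \<L>' \<Longrightarrow> |\<L>| \<le>o |\<L>'|" by blast
  have move: "\<exists>\<L>'. local_base X r \<L>' \<and> |\<L>'| \<le>o |\<M>|"
    if asm: "q \<in> topspace X" "r \<in> topspace X" "local_base X q \<M>" for q r \<M>
  proof -
    obtain f where f: "homeomorphic_map X X f" "f q = r"
      using X(1) asm(1,2) unfolding homogeneous_space_def by blast
    have "local_base X r ((`) f ` \<M>)"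
      using local_base_homeomorphic_image[OF f(1) asm(3,1)] f(2) by simp
    then show ?thesis using card_of_image by blast
  qed
  have "infinite \<L>"
  proof
    assume fin: "finite \<L>"
    have "openin X {q}" if q: "q \<in> topspace X" for q
    proof -
      obtain \<L>' where "local_base X q \<L>'" "|\<L>'| \<le>o |\<L>|" using move[OF p q L(1)] by blast
      then show ?thesis
        using finite_local_base_imp_open_singleton[OF X(2) q] card_of_ordLeq_finite[OF _ fin] by blast
    qed
    then have "discrete_topology (topspace X) = X" unfolding discrete_topology_unique by simp
    then have "compact_space (discrete_topology (topspace X))" using X(3) by simp
    then show False using X(4) by (simp add: compact_space_discrete_topology)
  qed
  show ?thesis
  proof (rule that)
    show "Cinfinite |\<L>|"
      using \<open>infinite \<L>\<close> unfolding cinfinite_def by (simp add: Field_card_of card_of_Card_order)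
    show "\<exists>\<L>'. local_base X q \<L>' \<and> |\<L>'| \<le>o |\<L>|" if "q \<in> topspace X" for q
      by (rule move[OF p that L(1)])
    show "|\<L>| \<le>o |\<M>|" if q: "q \<in> topspace X" "local_base X q \<M>" for q \<M>
    proof -
      obtain \<L>' where "local_base X p \<L>'" "|\<L>'| \<le>o |\<M>|" using move[OF q(1) p q(2)] by blast
      then show ?thesis using ordLeq_transitive[OF L(2)] by blast
    qed
  qed
qed

text \<open>
  The hypothesis speaks of cardinals on a larger type, into which \<open>Field \<mu>\<close> embeds.
\<close>
lemma GCH_upto_ctwo_cexp:
  fixes \<mu> :: "'a set rel"
  assumes GCH: "GCH_upto TYPE((nat + 'a set) set)" and \<mu>: "Cinfinite \<mu>"
  shows "ctwo ^c \<mu> \<le>o cardSuc \<mu>"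
proof -
  let ?e = "\<lambda>A. {Inr A} :: (nat + 'a set) set"
  let ?\<nu> = "|?e ` Field \<mu>|"
  have "bij_betw ?e (Field \<mu>) (?e ` Field \<mu>)" by (auto simp: bij_betw_def inj_on_def)
  then have "|Field \<mu>| =o ?\<nu>" using card_of_ordIso by blast
  then have iso: "\<mu> =o ?\<nu>"
    using ordIso_transitive[OF ordIso_symmetric[OF card_of_Field_ordIso]] \<mu> by blast
  have \<nu>: "Cinfinite ?\<nu>" by (rule Cinfinite_cong[OF iso \<mu>])
  have "ctwo ^c \<mu> =o ctwo ^c ?\<nu>"
    using \<mu> by (intro cexp_cong2 iso Card_order_ctwo) blast
  also have "ctwo ^c ?\<nu> =o cardSuc ?\<nu>" using GCH \<nu> unfolding GCH_upto_def by blast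
  also have "cardSuc ?\<nu> =o cardSuc \<mu>"
    using cardSuc_invar_ordIso[of ?\<nu> \<mu>] \<mu> \<nu> ordIso_symmetric[OF iso] by blast
  finally show ?thesis by (rule ordIso_imp_ordLeq)
qed

lemma exists_base_card_le:
  assumes \<nu>: "Cinfinite \<nu>" and T: "|topspace X| \<le>o \<nu>"
    and lb: "\<And>p. p \<in> topspace X \<Longrightarrow> \<exists>\<L>. local_base X p \<L> \<and> |\<L>| \<le>o \<nu>"
  obtains \<B> where "topology_base X \<B>" "|\<B>| \<le>o \<nu>"
proof -
  obtain L where L: "\<And>p. p \<in> topspace X \<Longrightarrow> local_base X p (L p) \<and> |L p| \<le>o \<nu>" using lb by metis
  show ?thesis
  proof
    show "|\<Union>p\<in>topspace X. L p| \<le>o \<nu>"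
      using L by (intro UNION_Cinfinite_bound T \<nu>) blast
    show "topology_base X (\<Union>p\<in>topspace X. L p)"
      unfolding topology_base_iff
    proof (intro conjI ballI allI impI)
      fix V assume "V \<in> (\<Union>p\<in>topspace X. L p)"
      then obtain p where "p \<in> topspace X" "V \<in> L p" by blast
      then show "openin X V" using L[of p] unfolding local_base_def by blast
    next
      fix U p assume U: "openin X U \<and> p \<in> U"
      then have p: "p \<in> topspace X" using openin_subset by blast
      obtain V where "V \<in> L p" "V \<subseteq> U" "p \<in> V" using L[OF p] U unfolding local_base_def by blast
      then show "\<exists>V\<in>(\<Union>p\<in>topspace X. L p). p \<in> V \<and> V \<subseteq> U" using p by blast
    qed
  qed
qed

text \<open>
  If the weight exceeds the character bound \<open>\<mu>\<close>, then op-likeness below \<open>\<mu>\<^sup>+\<^sup>+\<close> would leave each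
  member of the base with at most \<open>\<mu>\<close> supersets, which \<open>card_of_base_le_character\<close> rules out.
\<close>
lemma cardSuc_cardSuc_ordLeq_op_like:
  assumes Y: "compact_space Y" "Hausdorff_space Y" and \<mu>: "Cinfinite \<mu>"
    and lb: "\<And>p. p \<in> topspace Y \<Longrightarrow> \<exists>\<L>. local_base Y p \<L> \<and> |\<L>| \<le>o \<mu>"
    and weight: "\<And>\<B>. topology_base Y \<B> \<Longrightarrow> \<not> |\<B>| \<le>o \<mu>"
    and \<kappa>: "Card_order \<kappa>" and base: "has_op_like_base Y \<kappa>"
  shows "cardSuc (cardSuc \<mu>) \<le>o \<kappa>"
proof (rule ccontr)
  have Suc: "Cinfinite (cardSuc \<mu>)" by (rule Cinfinite_cardSuc[OF \<mu>])
  have Card: "Card_order (cardSuc \<mu>)" using Suc by blast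
  assume neg: "\<not> cardSuc (cardSuc \<mu>) \<le>o \<kappa>"
  have "\<not> cardSuc \<mu> <o \<kappa>" using cardSuc_ordLess_ordLeq[OF Card \<kappa>] neg by blast
  then have "\<kappa> \<le>o cardSuc \<mu>"
    using not_ordLess_iff_ordLeq Card \<kappa> unfolding card_order_on_def by blast
  then have "has_op_like_base Y (cardSuc \<mu>)" by (rule has_op_like_base_mono[OF base])
  then obtain \<B> where \<B>: "topology_base Y \<B>" "op_like (cardSuc \<mu>) \<B>"
    unfolding has_op_like_base_def by blast
  have "|\<B>| \<le>o \<mu>"
  proof (rule card_of_base_le_character[OF Y \<mu> lb \<B>(1)])
    show "|{V \<in> \<B>. U \<subseteq> V}| \<le>o \<mu>" if "U \<in> \<B>" for U
      using \<B>(2) that unfolding op_like_def card_of_ordLess_cardSuc_iff[OF \<mu>] by blast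
  qed
  then show False using weight[OF \<B>(1)] by blast
qed

lemma has_op_like_base_from_power:
  fixes X :: "'a topology"
  assumes GCH: "GCH_upto TYPE((nat + 'a set) set)"
    and X: "compact_space X" "Hausdorff_space X" "homogeneous_space X"
    and I: "finite I" "I \<noteq> {}" and \<kappa>: "Cinfinite \<kappa>"
    and pow: "has_op_like_base (product_topology (\<lambda>_. X) I) \<kappa>"
  shows "has_op_like_base X \<kappa>"
proof (cases "finite (topspace X)")
  case True
  have "topology_base X {U. openin X U}" unfolding topology_base_iff by blast
  moreover have "{U. openin X U} \<subseteq> Pow (topspace X)" using openin_subset by blast
  then have "finite {U. openin X U}" using True finite_subset by blast
  then have "op_like \<kappa> {U. openin X U}"
    unfolding op_like_def by (intro ballI card_finite_ordLess[OF \<kappa>]) simp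
  ultimately show ?thesis unfolding has_op_like_base_def by blast
next
  case False
  obtain \<mu> :: "'a set rel" where \<mu>: "Cinfinite \<mu>"
    and lb: "\<And>p. p \<in> topspace X \<Longrightarrow> \<exists>\<L>. local_base X p \<L> \<and> |\<L>| \<le>o \<mu>"
    and char: "\<And>p \<L>. p \<in> topspace X \<Longrightarrow> local_base X p \<L> \<Longrightarrow> \<mu> \<le>o |\<L>|"
    by (rule character_exists[OF X(3,2,1) False]) blast
  show ?thesis
  proof (cases "\<exists>\<E>. topology_base X \<E> \<and> |\<E>| \<le>o \<mu>")
    case True
    then obtain \<E> where "topology_base X \<E>" "|\<E>| \<le>o \<mu>" by blast
    then show ?thesis by (rule op_like_base_from_power[OF X(1,2) I \<mu> _ _ char \<kappa> pow])
  next
    case no: False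
    let ?Y = "product_topology (\<lambda>_. X) I"
    have Suc: "Cinfinite (cardSuc \<mu>)" by (rule Cinfinite_cardSuc[OF \<mu>])
    have lbS: "\<exists>\<L>. local_base X p \<L> \<and> |\<L>| \<le>o cardSuc \<mu>" if "p \<in> topspace X" for p
      using lb[OF that] ordLeq_transitive[OF _ cardSuc_ordLeq[OF conjunct2[OF \<mu>]]] by blast
    have "|topspace X| \<le>o cardSuc \<mu>"
      by (rule ordLeq_transitive[OF card_of_compact_space[OF X(1,2) \<mu> lb] GCH_upto_ctwo_cexp[OF GCH \<mu>]])
    then obtain \<E> where \<E>: "topology_base X \<E>" "|\<E>| \<le>o cardSuc \<mu>"
      using exists_base_card_le[OF Suc _ lbS] by blast
    have "|{V \<in> \<E>. U \<subseteq> V}| <o cardSuc (cardSuc \<mu>)" for U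
      unfolding card_of_ordLess_cardSuc_iff[OF Suc]
      by (rule ordLeq_transitive[OF card_of_mono1 \<E>(2)]) blast
    then have big: "has_op_like_base X (cardSuc (cardSuc \<mu>))"
      using \<E>(1) unfolding has_op_like_base_def op_like_def by blast
    have "cardSuc (cardSuc \<mu>) \<le>o \<kappa>"
    proof (rule cardSuc_cardSuc_ordLeq_op_like[OF _ _ \<mu> _ _ _ pow])
      show "compact_space ?Y" using X(1) by (simp add: compact_space_product_topology)
      show "Hausdorff_space ?Y" using X(2) by (simp add: Hausdorff_space_product_topology)
      show "\<exists>\<L>. local_base ?Y y \<L> \<and> |\<L>| \<le>o \<mu>" if "y \<in> topspace ?Y" for y
        by (rule local_base_power[OF I(1) \<mu> lb that])
      show "\<not> |\<B>| \<le>o \<mu>" if "topology_base ?Y \<B>" for \<B>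
      proof
        assume "|\<B>| \<le>o \<mu>"
        then show False
          using no topology_base_diagonal[OF that I] ordLeq_transitive[OF card_of_image] by blast
      qed
      show "Card_order \<kappa>" using \<kappa> by blast
    qed
    then show ?thesis by (rule has_op_like_base_mono[OF big])
  qed
qed

theorem corollary2p22:
  fixes X :: "'a topology" and n :: nat
  assumes "GCH_upto TYPE((nat + 'a set) set)"
    and "compact_space X" and "Hausdorff_space X" and "homogeneous_space X"
    and "n \<ge> 1"
  shows "Noetherian_type (product_topology (\<lambda>_. X) {..<n}) =o Noetherian_type X"
proof -
  let ?Y = "product_topology (\<lambda>_. X) {..<n}"
  have ne: "{..<n} \<noteq> {}" using assms(5) by (simp add: lessThan_empty_iff)
  have X: "Cinfinite (Noetherian_type X)" "has_op_like_base X (Noetherian_type X)"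
    using Noetherian_type_spec[of X] by blast+
  have Y: "Cinfinite (Noetherian_type ?Y)" "has_op_like_base ?Y (Noetherian_type ?Y)"
    using Noetherian_type_spec[of ?Y] by blast+
  have "Noetherian_type ?Y \<le>o Noetherian_type X"
    by (rule Noetherian_type_least[OF X(1) power_op_like_base[OF finite_lessThan X]])
  moreover have "Noetherian_type X \<le>o Noetherian_type ?Y"
    by (rule Noetherian_type_least[OF Y(1)
          has_op_like_base_from_power[OF assms(1-4) finite_lessThan ne Y]])
  ultimately show ?thesis unfolding ordIso_iff_ordLeq by blast
qed

end
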